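(* For each $x\in\mathbf{A}\cap T(\mathcal{Z})$, the $\widetilde{T}$-orbit $(\widetilde{T}^n(x))_{n\ge0}$ is uniformly distributed in $Y'$ with respect to the self-similar measure $\nu$; that is, for every continuous function $f:Y'\to\mathbb{R}$, $$\lim_{N\to\infty}\frac1N\sum_{n=0}^{N-1}f(\widetilde{T}^n(x))=\int_{Y'}f\,d\nu .$$
   Context: Let $\zeta=\exp(2\pi i/5)$ and $\omega=\frac{1+\sqrt5}{2}$. Let $L=[0,1)+(-\zeta^{-1})[0,1)=\{s-t\zeta^{-1}: s,t\in[0,1)\}\subset\mathbb{C}$, and put $\Delta=\{x\in L:\operatorname{Im}(x/\zeta)\ge 0\}$, $\mathcal{Z}=L\setminus\Delta$. The map $T:L\to L$ is the bijective piecewise isometry $T(x)=x/\zeta$ for $x\in\Delta$ and $T(x)=(x-1)/\zeta$ for $x\in\mathcal{Z}$. $\mathbf{A}\subset L$ denotes the set of points whose $T$-orbit is not periodic. $\widetilde{T}$ is the first return map of $T$ to $T(\mathcal{Z})$; explicitly, for $x\in T(\mathcal{Z})$, $\widetilde{T}(x)=T^2(x)$ if $x\in\Delta$ and $\widetilde{T}(x)=T(x)$ if $x\in T(\mathcal{Z})\setminus\Delta$. Put $d_0=0$, $d_2=\zeta$, $d_3=\zeta/\omega$, $d_5=-\frac{1}{\omega\zeta}$. $Y'$ is the unique non-empty compact subset of $\mathbb{C}$ satisfying $Y'=\bigcup_{m\in\{0,2,3,5\}}\left(\frac{\zeta^m}{\omega^2}Y'+d_m\right)$; one has $\mathbf{A}\cap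 T(\mathcal{Z})\subset Y'$, and $\widetilde{T}$ maps $\mathbf{A}\cap T(\mathcal{Z})$ into itself. $\nu$ is the unique Borel probability measure on $Y'$ satisfying $$\nu(X)=\frac14\sum_{m\in\{0,2,3,5\}}\nu\left(\frac{\omega^2}{\zeta^m}(X-d_m)\right)$$ for all measurable $X$. *)

theory Defs
  imports "HOL-Probability.Probability"
begin

definition zeta5 :: complex where
  "zeta5 = exp (2 * of_real pi * \<i> / 5)"

definition golden :: real where
  "golden = (1 + sqrt 5) / 2"

definition dom_L :: "complex set" where
  "dom_L = {of_real s - of_real t * inverse zeta5 | s t :: real. s \<in> {0..<1} \<and> t \<in> {0..<1}}"

definition dom_Delta :: "complex set" where
  "dom_Delta = {x \<in> dom_L. Im (x / zeta5) \<ge> 0}"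

definition dom_Z :: "complex set" where
  "dom_Z = dom_L - dom_Delta"

text \<open>Only the values of \<open>piso\<close> on \<^term>\<open>dom_L\<close> are meaningful.\<close>

definition piso :: "complex \<Rightarrow> complex" where
  "piso x = (if x \<in> dom_Delta then x / zeta5 else (x - 1) / zeta5)"

text \<open>As \<open>piso\<close> permutes \<^term>\<open>dom_L\<close>, an orbit is periodic iff it returns to its starting point.\<close>

definition aperiodic_pts :: "complex set" where
  "aperiodic_pts = {x \<in> dom_L. \<not> (\<exists>n>0. (piso ^^ n) x = x)}"

definition first_return :: "('a \<Rightarrow> 'a) \<Rightarrow> 'a set \<Rightarrow> 'a \<Rightarrow> 'a" where
  "first_return g S x = (g ^^ (LEAST n. n > 0 \<and> (g ^^ n) x \<in> S)) x"

definition piso_ret :: "complex \<Rightarrow> complex" where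
  "piso_ret = first_return piso (piso ` dom_Z)"

definition ifs_idx :: "nat set" where
  "ifs_idx = {0, 2, 3, 5}"

definition ifs_d :: "nat \<Rightarrow> complex" where
  "ifs_d m = (if m = 2 then zeta5
              else if m = 3 then zeta5 / of_real golden
              else if m = 5 then - 1 / (of_real golden * zeta5)
              else 0)"

definition attractor :: "complex set" where
  "attractor = (THE Y. Y \<noteq> {} \<and> compact Y \<and>
     Y = (\<Union>m\<in>ifs_idx. (\<lambda>y. zeta5 ^ m / of_real (golden\<^sup>2) * y + ifs_d m) ` Y))"

text \<open>
  The measure is taken on the Borel sets of the whole plane, with full mass on the attractor:
  the sets on the right-hand side of the self-similarity equation need not be subsets of the
  attractor.
\<close>

definition self_sim_measure :: "complex measure" where
  "self_sim_measure = (THE M. prob_space M \<and> sets M = sets borel \<and> measure M attractor = 1 \<and>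
     (\<forall>X\<in>sets borel. measure M X =
        1 / 4 * (\<Sum>m\<in>ifs_idx.
          measure M ((\<lambda>x. of_real (golden\<^sup>2) / zeta5 ^ m * (x - ifs_d m)) ` X))))"

text \<open>
  Consistency check: the first return map has the expected explicit form. In the coordinates
  \<open>x = s - t / zeta5\<close> the map \<open>piso\<close> sends \<open>(s, t)\<close> to
  \<open>(t, frac (t / golden - s))\<close>.
\<close>

abbreviation (input) pt :: "real \<Rightarrow> real \<Rightarrow> complex" where
  "pt s t \<equiv> of_real s - of_real t * inverse zeta5"

lemma golden_pos: "golden > 0" "golden > 1"
  by (auto simp: golden_def add_pos_pos)

lemma golden_sq: "golden\<^sup>2 = golden + 1"
  by (simp add: golden_def power2_eq_square field_simps)

lemma zeta5_cis: "zeta5 = cis (2 * pi / 5)"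
  by (simp add: zeta5_def cis_conv_exp mult_ac)

lemma sin_pos: "sin (2 * pi / 5) > 0"
  by (rule sin_gt_zero) auto

lemma cos_2pi_5: "2 * cos (2 * pi / 5) = 1 / golden"
proof -
  let ?a = "2 * pi / 5" and ?c = "2 * cos (2 * pi / 5)"
  have pos: "?c > 0" by (auto intro!: cos_gt_zero)
  have "cos (3 * ?a) = cos (2 * pi - 2 * ?a)" by (rule arg_cong[where f = cos]) simp
  also have "\<dots> = cos (2 * ?a)" by (simp only: cos_2pi_minus)
  finally have "4 * cos ?a ^ 3 - 3 * cos ?a = 2 * (cos ?a)\<^sup>2 - 1"
    by (simp only: cos_treble_cos cos_double_cos)
  hence "(?c - 2) * (?c\<^sup>2 + ?c - 1) = 0"
    by (simp add: power2_eq_square power3_eq_cube algebra_simps)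
  moreover have "cos ?a < cos 0" by (rule cos_monotone_0_pi) auto
  hence "?c \<noteq> 2" by simp
  ultimately have c: "?c\<^sup>2 + ?c - 1 = 0" by simp
  have g: "(1 / golden)\<^sup>2 + 1 / golden - 1 = 0"
    using golden_sq golden_pos by (simp add: field_simps power2_eq_square)
  have "(?c - 1 / golden) * (?c + 1 / golden + 1) = 0"
    using c g by (simp add: power2_eq_square algebra_simps)
  moreover have "?c + 1 / golden + 1 > 0" using pos golden_pos by (simp add: add_pos_pos)
  ultimately show ?thesis by simp
qed

lemma inverse_zeta5: "Re (inverse zeta5) = 1 / (2 * golden)"
    "Im (inverse zeta5) = - sin (2 * pi / 5)"
proof -
  have "cos (2 * pi / 5) = 1 / (2 * golden)" using cos_2pi_5 by simp
  thus "Re (inverse zeta5) = 1 / (2 * golden)" "Im (inverse zeta5) = - sin (2 * pi / 5)"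
    unfolding zeta5_cis cis_inverse by (simp_all only: cis.sel cos_minus sin_minus)
qed

lemma inverse_zeta5_sq:
  "inverse zeta5 * inverse zeta5 = of_real (1 / golden) * inverse zeta5 - 1"
proof (rule complex_eqI)
  have "(sin (2 * pi / 5))\<^sup>2 = 1 - (1 / (2 * golden))\<^sup>2"
  proof -
    have "cos (2 * pi / 5) = 1 / (2 * golden)" using cos_2pi_5 by simp
    thus ?thesis by (simp only: sin_squared_eq)
  qed
  thus "Re (inverse zeta5 * inverse zeta5) =
        Re (of_real (1 / golden) * inverse zeta5 - 1)"
    by (simp add: inverse_zeta5 power2_eq_square del: inverse_complex.sel)
  show "Im (inverse zeta5 * inverse zeta5) =
        Im (of_real (1 / golden) * inverse zeta5 - 1)"
    unfolding times_complex.sel minus_complex.sel inverse_zeta5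
    using golden_pos by (simp add: field_simps)
qed

lemma pt_inj: "pt s t = pt s' t' \<longleftrightarrow> s = s' \<and> t = t'"
proof
  assume *: "pt s t = pt s' t'"
  have "Im (pt s t) = t * sin (2 * pi / 5)" "Im (pt s' t') = t' * sin (2 * pi / 5)"
    by (simp_all del: inverse_complex.sel add: inverse_zeta5)
  with * sin_pos have "t = t'" by simp
  with * show "s = s' \<and> t = t'" by simp
qed auto

lemma pt_div: "pt s t / zeta5 = pt t (t / golden - s)"
proof -
  have "pt s t / zeta5 = of_real s * inverse zeta5
      - of_real t * (inverse zeta5 * inverse zeta5)"
    by (simp add: divide_inverse algebra_simps)
  thus ?thesis unfolding inverse_zeta5_sq
    by (simp add: algebra_simps)
qed

lemma pt_in_L: "pt s t \<in> dom_L \<longleftrightarrow> s \<in> {0..<1} \<and> t \<in> {0..<1}"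
  unfolding dom_L_def by (auto simp: pt_inj simp del: of_real_eq_iff)

lemma Im_pt_div: "Im (pt s t / zeta5) = (t / golden - s) * sin (2 * pi / 5)"
  unfolding pt_div
  by (simp del: inverse_complex.sel add: inverse_zeta5)

lemma pt_in_Delta:
  "pt s t \<in> dom_Delta \<longleftrightarrow> s \<in> {0..<1} \<and> t \<in> {0..<1} \<and> t / golden \<ge> s"
  using sin_pos unfolding dom_Delta_def
  by (simp only: mem_Collect_eq pt_in_L Im_pt_div) (auto simp: zero_le_mult_iff)

lemma pt_in_Z:
  "pt s t \<in> dom_Z \<longleftrightarrow> s \<in> {0..<1} \<and> t \<in> {0..<1} \<and> t / golden < s"
  unfolding dom_Z_def by (simp only: Diff_iff pt_in_L pt_in_Delta) auto

lemma piso_pt: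
  assumes "s \<in> {0..<1}" "t \<in> {0..<1}"
  shows "piso (pt s t) = (if t / golden \<ge> s then pt t (t / golden - s)
                           else pt t (t / golden - s + 1))"
proof -
  have "(pt s t - 1) / zeta5 = pt (s - 1) t / zeta5" by simp
  also have "\<dots> = pt t (t / golden - s + 1)" unfolding pt_div by simp
  finally show ?thesis
    unfolding piso_def using assms by (simp only: pt_in_Delta pt_div) auto
qed

lemma pt_in_piso_Z:
  "pt s t \<in> piso ` dom_Z \<longleftrightarrow> s \<in> {0..<1} \<and> t \<in> {0..<1} \<and> s / golden < t"
proof
  assume "pt s t \<in> piso ` dom_Z"
  then obtain y where y: "y \<in> dom_Z" "pt s t = piso y" by auto
  then obtain a b where ab: "y = pt a b" unfolding dom_Z_def dom_L_def by auto
  have r: "a \<in> {0..<1}" "b \<in> {0..<1}" "b / golden < a"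
    using y(1) unfolding ab pt_in_Z by auto
  hence "pt s t = pt b (b / golden - a + 1)"
    using y(2) unfolding ab by (simp only: piso_pt) auto
  hence e: "s = b" "t = b / golden - a + 1" unfolding pt_inj by auto
  have "b / golden \<ge> 0" using r golden_pos by simp
  thus "s \<in> {0..<1} \<and> t \<in> {0..<1} \<and> s / golden < t"
    using r unfolding e by auto
next
  assume r: "s \<in> {0..<1} \<and> t \<in> {0..<1} \<and> s / golden < t"
  define a where "a = s / golden - t + 1"
  have "s / golden \<ge> 0" using r golden_pos by simp
  hence a: "a \<in> {0..<1}" "s / golden < a" using r unfolding a_def by auto
  have "piso (pt a s) = pt s t"
    using a r by (simp only: piso_pt) (simp add: a_def)
  moreover have "pt a s \<in> dom_Z" unfolding pt_in_Z using a r by simp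
  ultimately show "pt s t \<in> piso ` dom_Z" by (metis imageI)
qed

lemma piso_bij: "bij_betw piso dom_L dom_L"
proof (rule bij_betw_imageI)
  show "inj_on piso dom_L"
  proof (rule inj_onI)
    fix x y assume xy: "x \<in> dom_L" "y \<in> dom_L" "piso x = piso y"
    obtain a b where x: "x = pt a b" "a \<in> {0..<1}" "b \<in> {0..<1}"
      using xy(1) unfolding dom_L_def by auto
    obtain c d where y: "y = pt c d" "c \<in> {0..<1}" "d \<in> {0..<1}"
      using xy(2) unfolding dom_L_def by auto
    have "pt b (if b / golden \<ge> a then b / golden - a else b / golden - a + 1) =
          pt d (if d / golden \<ge> c then d / golden - c else d / golden - c + 1)"
      using xy(3) x y by (simp only: piso_pt) (simp split: if_splits)
    hence "b = d" "(if b / golden \<ge> a then b / golden - a else b / golden - a + 1) =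
          (if d / golden \<ge> c then d / golden - c else d / golden - c + 1)"
      unfolding pt_inj by auto
    hence "a = c" "b = d" using x y by (auto split: if_splits)
    thus "x = y" using x y by simp
  qed
  show "piso ` dom_L = dom_L"
  proof (intro equalityI subsetI)
    fix z assume "z \<in> piso ` dom_L"
    then obtain a b where z: "z = piso (pt a b)" "a \<in> {0..<1}" "b \<in> {0..<1}"
      unfolding dom_L_def by auto
    have "0 \<le> b / golden" "b / golden < 1" using z golden_pos by auto
    thus "z \<in> dom_L" using z by (simp only: piso_pt) (auto simp del: of_real_diff of_real_add of_real_divide simp: pt_in_L)
  next
    fix z assume "z \<in> dom_L"
    then obtain s t where z: "z = pt s t" "s \<in> {0..<1}" "t \<in> {0..<1}"
      unfolding dom_L_def by auto
    define a where "a = (if s / golden \<ge> t then s / golden - t else s / golden - t + 1)"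
    have "0 \<le> s / golden" "s / golden < 1" using z golden_pos by auto
    hence a: "a \<in> {0..<1}" using z by (auto simp: a_def)
    have "piso (pt a s) = pt s t"
      using a z by (simp only: piso_pt) (auto simp: a_def)
    moreover have "pt a s \<in> dom_L" unfolding pt_in_L using a z by simp
    ultimately show "z \<in> piso ` dom_L" using z by (metis imageI)
  qed
qed

lemma piso_ret_explicit:
  assumes "x \<in> piso ` dom_Z"
  shows "piso_ret x = (if x \<in> dom_Delta then piso (piso x) else piso x)"
proof -
  let ?P = "\<lambda>n. n > 0 \<and> (piso ^^ n) x \<in> piso ` dom_Z"
  have inL: "x \<in> dom_L"
    using assms bij_betw_imp_surj_on[OF piso_bij] unfolding dom_Z_def by blast
  then obtain s t where x: "x = pt s t" unfolding dom_L_def by auto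
  have r: "s \<in> {0..<1}" "t \<in> {0..<1}" "s / golden < t"
    using assms unfolding x pt_in_piso_Z by auto
  show ?thesis
  proof (cases "x \<in> dom_Delta")
    case False
    hence "x \<in> dom_Z" using inL by (simp add: dom_Z_def)
    hence "(LEAST n. ?P n) = 1" by (intro Least_equality) auto
    thus ?thesis using False by (simp add: piso_ret_def first_return_def)
  next
    case True
    hence u: "t / golden \<ge> s" unfolding x pt_in_Delta by auto
    have p: "piso x = pt t (t / golden - s)"
      unfolding x using r u by (simp only: piso_pt) simp
    have s0: "s / golden \<ge> 0" using r golden_pos by simp
    have "t > 0" using r s0 by linarith
    hence t1: "t / golden < t" using golden_pos by (simp add: field_simps)
    have "(t / golden - s) / golden \<le> t / golden"
      using r golden_pos t1 by (intro divide_right_mono) auto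
    hence "(t / golden - s) / golden < t" using t1 by simp
    hence "piso x \<in> dom_Z" unfolding p pt_in_Z using r u t1 by auto
    hence 2: "?P 2" by (simp add: numeral_2_eq_2)
    have "\<not> t / golden < t / golden - s" using r by simp
    hence "piso x \<notin> piso ` dom_Z" unfolding p pt_in_piso_Z by blast
    hence 1: "\<not> ?P 1" by simp
    have "(LEAST n. ?P n) = 2"
    proof (rule Least_equality)
      show "?P 2" by (rule 2)
    next
      fix n assume "?P n"
      hence "n \<noteq> 1" "n > 0" using 1 by metis+
      thus "2 \<le> n" by simp
    qed
    thus ?thesis using True by (simp add: piso_ret_def first_return_def numeral_2_eq_2)
  qed
qed

end

theory Submission
  imports Defs
begin

text \<open>
  Write \<open>U\<close> for the image of \<open>dom_Z\<close> under \<open>piso\<close>, \<open>R\<close> for the return map \<open>piso_ret\<close> of \<open>U\<close>, and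
  \<open>S_m y = (zeta5 ^ m / golden\<^sup>2) y + ifs_d m\<close> for the four similarities that define the attractor.

  The map \<open>R\<close> is an odometer on its aperiodic points. On all of \<open>U\<close> the relations
  \<open>R S_5 = S_3\<close>, \<open>R S_3 = S_2\<close>, \<open>R S_2 = S_0\<close> and \<open>R S_0 = S_5 R\<close> hold (\<open>ret_shrink\<close>), so \<open>R\<close> runs
  cyclically through the four small copies of \<open>U\<close>, and \<open>R ^^ 4\<close> acts on each copy as \<open>R\<close> acts on
  \<open>U\<close>. The orbit of a point of \<open>U\<close> outside the four copies uses only one of the two branches of
  \<open>R\<close>; a branch is a rotation of order five, so the point is periodic (\<open>uncovered_periodic\<close>).
  Hence every aperiodic point of \<open>U\<close> is \<open>S_m p\<close> with \<open>p\<close> again aperiodic in \<open>U\<close>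
  (\<open>ret_aperiodic_shrink\<close>). Repeating this, aperiodic points lie in the attractor.

  An orbit that passes through \<open>S_5 p\<close> visits \<open>S_5 p, S_3 p, S_2 p, S_0 p\<close> in turn and continues
  with the same four images of \<open>R p\<close>. So the averages of a function \<open>F\<close> along the orbit of \<open>S_m p\<close>
  are asymptotic to the averages of the function \<open>x \<mapsto> (F (S_0 x) + F (S_2 x) + F (S_3 x) + F (S_5 x)) / 4\<close>
  along the orbit of \<open>p\<close> (\<open>orbit_avg_shrink\<close>). Call this function the transfer of \<open>F\<close>. After
  \<open>k\<close> repetitions the orbit average of \<open>F\<close> has become an orbit average of the \<open>k\<close>-th transfer of
  \<open>F\<close>. On the attractor that function oscillates no more than \<open>F\<close> does on sets whose diameter is
  smaller by the factor \<open>golden ^ (2 k)\<close>, and its integral is that of \<open>F\<close>, because the measure is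
  self-similar. So it is uniformly close to the constant \<open>\<integral> F\<close>, and so are all its averages.

  The attractor and the self-similar measure are given by definite descriptions. They denote what
  they should because every finite nonempty family of contractions has exactly one attractor and exactly one
  invariant probability measure on it.
\<close>

section \<open>Attractors and invariant measures of contracting families\<close>

text \<open>
  The indicator function of a closed set is the pointwise limit of bounded continuous functions,
  and the closed sets form an intersection-stable generator of the Borel sets.
\<close>

lemma borel_prob_eqI:
  fixes M N :: "'a::metric_space measure"
  assumes M: "prob_space M" "sets M = sets borel" and N: "prob_space N" "sets N = sets borel"
    and eq: "\<And>F :: 'a \<Rightarrow> real. continuous_on UNIV F \<Longrightarrow> (\<And>x. \<bar>F x\<bar> \<le> 1) \<Longrightarrow> (\<integral>x. F x \<partial>M) = (\<integral>x. F x \<partial>N)"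
  shows "M = N"
proof -
  interpret M: prob_space M by fact
  interpret N: prob_space N by fact
  have closed_eq: "emeasure M C = emeasure N C" if C: "closed C" for C
  proof (cases "C = {}")
    case False
    \<comment> \<open>A tent of height one over \<open>C\<close> that vanishes at distance \<open>1 / n\<close>.\<close>
    define F where "F = (\<lambda>n x. max 0 (1 - real n * infdist x C))"
    have cont: "continuous_on UNIV (F n)" for n
      unfolding F_def by (intro continuous_intros)
    have bnd: "\<bar>F n x\<bar> \<le> 1" for n x
      unfolding F_def by (auto simp: infdist_nonneg)
    have lim: "(\<lambda>n. F n x) \<longlonglongrightarrow> indicator C x" for x
    proof (cases "x \<in> C")
      case True
      thus ?thesis by (simp add: F_def)
    next
      case out: False
      hence "infdist x C > 0"
        using in_closed_iff_infdist_zero[OF C False] infdist_nonneg[of x C] by fastforce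
      then obtain n0 where n0: "1 < real n0 * infdist x C" using reals_Archimedean3 by blast
      have "F n x = 0" if "n \<ge> n0" for n
      proof -
        have "real n0 * infdist x C \<le> real n * infdist x C"
          using that by (intro mult_right_mono infdist_nonneg) simp
        thus ?thesis using n0 by (simp add: F_def)
      qed
      hence "\<forall>\<^sub>F n in sequentially. F n x = indicator C x"
        using out eventually_sequentially by auto
      thus ?thesis by (rule tendsto_eventually)
    qed
    have int_lim: "(\<lambda>n. \<integral>x. F n x \<partial>L) \<longlonglongrightarrow> measure L C" if "prob_space L" "sets L = sets borel" for L
    proof -
      interpret L: prob_space L by fact
      note [measurable_cong] = that(2)
      have [measurable]: "F n \<in> borel_measurable L" for n
        using borel_measurable_continuous_onI[OF cont] by (simp add: measurable_def that(2) sets_eq_imp_space_eq[OF that(2)])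
      have CL: "C \<in> sets L" using C that(2) by simp
      have "(\<lambda>n. \<integral>x. F n x \<partial>L) \<longlonglongrightarrow> (\<integral>x. indicator C x \<partial>L)"
        by (rule integral_dominated_convergence[where w = "\<lambda>_. 1"]) (use CL lim bnd in auto)
      also have "(\<integral>x. indicator C x \<partial>L) = measure L C"
        using CL by (simp add: sets.Int_space_eq2)
      finally show ?thesis .
    qed
    have "(\<lambda>n. \<integral>x. F n x \<partial>N) \<longlonglongrightarrow> measure M C"
      using int_lim[OF M] eq[OF cont bnd] by simp
    hence "measure M C = measure N C" using int_lim[OF N] LIMSEQ_unique by blast
    thus ?thesis by (simp add: M.emeasure_eq_measure N.emeasure_eq_measure)
  qed simp
  show ?thesis
  proof (rule measure_eqI_generator_eq[where E = "Collect closed" and \<Omega> = UNIV and A = "\<lambda>_. UNIV"])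
    show "Int_stable (Collect closed :: 'a set set)" by (auto simp: Int_stable_def)
    show "sets M = sigma_sets UNIV (Collect closed)" "sets N = sigma_sets UNIV (Collect closed)"
      using M(2) N(2) by (simp_all add: borel_eq_closed)
  qed (use closed_eq in auto)
qed

locale iterated_function_system =
  fixes I :: "'i set" and \<phi> :: "'i \<Rightarrow> 'a::euclidean_space \<Rightarrow> 'a" and r :: real
  assumes fin: "finite I" and ne: "I \<noteq> {}" and r: "0 \<le> r" "r < 1"
    and contr: "\<And>i x y. i \<in> I \<Longrightarrow> dist (\<phi> i x) (\<phi> i y) \<le> r * dist x y"
begin

definition hutchinson :: "'a set \<Rightarrow> 'a set" where
  "hutchinson A = (\<Union>i\<in>I. \<phi> i ` A)"

definition is_attractor :: "'a set \<Rightarrow> bool" where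
  "is_attractor Y \<longleftrightarrow> Y \<noteq> {} \<and> compact Y \<and> Y = hutchinson Y"

definition invariant_prob :: "'a set \<Rightarrow> 'a measure \<Rightarrow> bool" where
  "invariant_prob Y M \<longleftrightarrow> prob_space M \<and> sets M = sets borel \<and> measure M Y = 1 \<and>
     (\<forall>X\<in>sets borel. measure M X = (\<Sum>i\<in>I. measure M (\<phi> i -` X)) / real (card I))"

text \<open>
  The Markov operator of the random map that picks \<open>\<phi> i\<close> with equal weights. It is dual to the
  map on measures whose fixed points are the invariant ones.
\<close>
definition transfer :: "('a \<Rightarrow> real) \<Rightarrow> 'a \<Rightarrow> real" where
  "transfer F x = (\<Sum>i\<in>I. F (\<phi> i x)) / real (card I)"

lemma card_pos: "real (card I) > 0"
  using fin ne by (simp add: card_gt_0_iff)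

lemma continuous_phi: "i \<in> I \<Longrightarrow> continuous_on A (\<phi> i)"
  using contr r by (intro lipschitz_on_continuous_on[of r] lipschitz_onI) auto

text \<open>
  The distance from a point of \<open>B\<close> to the attractor is at most \<open>r\<close> times the distance from a point
  of \<open>B\<close> of which it is the image. As \<open>B\<close> is bounded, repeating this makes the distance zero.
  Applied to a second attractor, this gives uniqueness.
\<close>
lemma bounded_subset_attractor:
  assumes Y: "is_attractor Y" and B: "bounded B" "B \<subseteq> hutchinson B"
  shows "B \<subseteq> Y"
proof -
  have cl: "closed Y" "Y \<noteq> {}" using Y by (auto simp: is_attractor_def compact_imp_closed)
  then obtain y0 where y0: "y0 \<in> Y" by blast
  obtain D where D: "\<And>b. b \<in> B \<Longrightarrow> dist y0 b \<le> D" using B(1) bounded_any_center[of B y0] by auto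
  have le: "\<forall>b\<in>B. infdist b Y \<le> r ^ k * D" for k
  proof (induction k)
    case 0
    show ?case using D y0 infdist_le[OF y0] by (auto simp: dist_commute intro: order_trans)
  next
    case (Suc k)
    show ?case
    proof
      fix b assume "b \<in> B"
      then obtain i b' where b: "i \<in> I" "b' \<in> B" "b = \<phi> i b'"
        using B(2) by (auto simp: hutchinson_def)
      obtain y where y: "y \<in> Y" "infdist b' Y = dist b' y" using infdist_attains_inf[OF cl] .
      have "\<phi> i y \<in> Y" using Y y(1) b(1) by (auto simp: is_attractor_def hutchinson_def)
      hence "infdist b Y \<le> dist b (\<phi> i y)" by (rule infdist_le)
      also have "\<dots> \<le> r * infdist b' Y" unfolding b(3) y(2) by (rule contr[OF b(1)])
      also have "\<dots> \<le> r * (r ^ k * D)" using Suc b(2) r(1) by (intro mult_left_mono) auto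
      finally show "infdist b Y \<le> r ^ Suc k * D" by simp
    qed
  qed
  have "(\<lambda>k. r ^ k * D) \<longlonglongrightarrow> 0 * D" using r by (intro tendsto_intros LIMSEQ_realpow_zero) auto
  hence lim: "(\<lambda>k. r ^ k * D) \<longlonglongrightarrow> 0" by simp
  show ?thesis
  proof
    fix b assume "b \<in> B"
    hence "infdist b Y \<le> 0" using le by (intro LIMSEQ_le_const[OF lim]) auto
    hence "infdist b Y = 0" using infdist_nonneg[of b Y] by simp
    thus "b \<in> Y" using in_closed_iff_infdist_zero[OF cl] by blast
  qed
qed

lemma attractor_subset:
  assumes "is_attractor Y" "is_attractor Y'" shows "Y' \<subseteq> Y"
proof (rule bounded_subset_attractor[OF assms(1)])
  show "bounded Y'" using assms(2) by (simp add: is_attractor_def compact_imp_bounded)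
  show "Y' \<subseteq> hutchinson Y'" using assms(2) unfolding is_attractor_def by (metis order_refl)
qed

lemma attractor_unique: "is_attractor Y \<Longrightarrow> is_attractor Y' \<Longrightarrow> Y = Y'"
  by (intro equalityI attractor_subset)

lemma hutchinson_mono: "A \<subseteq> B \<Longrightarrow> hutchinson A \<subseteq> hutchinson B"
  by (auto simp: hutchinson_def)

text \<open>
  A ball that all the maps send into itself has decreasing images under the powers of
  \<open>hutchinson\<close>, and their intersection is the attractor. The delicate inclusion is
  \<open>Y \<subseteq> hutchinson Y\<close>: the index of a map with \<open>y \<in> \<phi> i ` E k\<close> may depend on \<open>k\<close>. By the
  pigeonhole principle one index serves infinitely many \<open>k\<close>, hence all of them, and the preimages
  of \<open>y\<close> under that map are found by compactness once more.
\<close>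
lemma attractor_exists: "\<exists>Y. is_attractor Y"
proof -
  \<comment> \<open>The radius satisfies \<open>norm (\<phi> i 0) + r * \<rho> \<le> \<rho>\<close>, so the maps send the ball into itself.\<close>
  define \<rho> where "\<rho> = (\<Sum>i\<in>I. norm (\<phi> i 0)) / (1 - r)"
  define E where "E = (\<lambda>k. (hutchinson ^^ k) (cball 0 \<rho>))"
  have E_Suc: "E (Suc k) = hutchinson (E k)" for k by (simp add: E_def)
  have \<rho>: "\<rho> \<ge> 0" using r by (auto simp: \<rho>_def intro!: divide_nonneg_pos sum_nonneg)
  have "norm (\<phi> i x) \<le> \<rho>" if "i \<in> I" "norm x \<le> \<rho>" for i x
  proof -
    have "norm (\<phi> i x) \<le> norm (\<phi> i 0) + dist (\<phi> i x) (\<phi> i 0)"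
      using norm_triangle_sub[of "\<phi> i x" "\<phi> i 0"] by (simp add: dist_norm)
    also have "norm (\<phi> i 0) \<le> (\<Sum>i\<in>I. norm (\<phi> i 0))" using that fin by (intro member_le_sum) auto
    also have "\<dots> = (1 - r) * \<rho>" using r by (simp add: \<rho>_def)
    also have "dist (\<phi> i x) (\<phi> i 0) \<le> r * dist x 0" by (rule contr[OF that(1)])
    also have "\<dots> \<le> r * \<rho>" using that r by (intro mult_left_mono) auto
    finally show ?thesis by (simp add: algebra_simps)
  qed
  hence E1: "E (Suc 0) \<subseteq> E 0" by (auto simp: E_def hutchinson_def)
  have step: "E (Suc k) \<subseteq> E k" for k
    by (induction k) (use E1 E_Suc hutchinson_mono in metis)+
  have dec: "E n \<subseteq> E m" if "m \<le> n" for m n using that step by (rule lift_Suc_antimono_le[rotated])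
  have E: "compact (E k) \<and> E k \<noteq> {}" for k
  proof (induction k)
    case (Suc k)
    thus ?case unfolding E_Suc hutchinson_def
      using fin ne continuous_phi by (auto intro!: compact_UN compact_continuous_image)
  qed (use \<rho> in \<open>auto simp: E_def\<close>)
  define Y where "Y = (\<Inter>k. E k)"
  have Yne: "Y \<noteq> {}" unfolding Y_def using E dec by (intro compact_nest) auto
  have Yc: "compact Y" unfolding Y_def using E by (intro compact_Inter) auto
  have "hutchinson Y \<subseteq> Y"
  proof -
    have "hutchinson Y \<subseteq> E (Suc k)" for k unfolding E_Suc by (rule hutchinson_mono) (auto simp: Y_def)
    hence "hutchinson Y \<subseteq> E k" for k using step[of k] by (meson order_trans)
    thus ?thesis unfolding Y_def by (intro INT_greatest)
  qed
  moreover have "y \<in> hutchinson Y" if y: "y \<in> Y" for y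
  proof -
    have "\<exists>i\<in>I. \<exists>x\<in>E k. y = \<phi> i x" for k
    proof -
      have "y \<in> hutchinson (E k)" using y unfolding Y_def E_Suc[symmetric] by blast
      thus ?thesis by (auto simp: hutchinson_def)
    qed
    then obtain i where i: "\<And>k. i k \<in> I" "\<And>k. y \<in> \<phi> (i k) ` E k" by (metis imageI)
    obtain j where j: "j \<in> I" "infinite {k. i k = j}"
    proof -
      have "\<not> (\<forall>j\<in>I. finite {k. i k = j})"
      proof
        assume "\<forall>j\<in>I. finite {k. i k = j}"
        hence "finite (\<Union>j\<in>I. {k. i k = j})" using fin by blast
        moreover have "(\<Union>j\<in>I. {k. i k = j}) = UNIV" using i(1) by auto
        ultimately show False by simp
      qed
      thus ?thesis using that by blast
    qed
    have jk: "y \<in> \<phi> j ` E k" for k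
    proof -
      obtain n where "n \<ge> k" "i n = j" using j(2) infinite_nat_iff_unbounded_le by auto
      thus ?thesis using i(2)[of n] dec[of k n] by blast
    qed
    define G where "G = (\<lambda>k. E k \<inter> \<phi> j -` {y})"
    have "\<Inter>(range G) \<noteq> {}"
    proof (rule compact_nest)
      fix n
      have "closed (\<phi> j -` {y})" using continuous_phi[OF j(1), of UNIV] by (simp add: continuous_on_closed_vimage)
      thus "compact (G n)" using E by (auto simp: G_def intro: compact_Int_closed)
      show "G n \<noteq> {}" using jk[of n] by (auto simp: G_def)
    qed (use dec in \<open>auto simp: G_def\<close>)
    then obtain x where "\<forall>k. x \<in> E k \<and> \<phi> j x = y" by (auto simp: G_def)
    thus ?thesis using j(1) by (auto simp: hutchinson_def Y_def)
  qed
  ultimately show ?thesis using Yne Yc by (auto simp: is_attractor_def)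
qed

lemma continuous_transfer:
  assumes "continuous_on UNIV F" shows "continuous_on UNIV (transfer F)"
proof -
  have "continuous_on UNIV (\<lambda>x. F (\<phi> i x))" if "i \<in> I" for i
    by (rule continuous_on_compose2[OF assms continuous_phi[OF that]]) simp
  thus ?thesis
    unfolding transfer_def[abs_def] using card_pos
    by (intro continuous_on_divide continuous_on_sum continuous_on_const) auto
qed

lemma transfer_bound:
  assumes "\<And>x. \<bar>F x\<bar> \<le> C" shows "\<bar>transfer F x\<bar> \<le> C"
proof -
  have "\<bar>\<Sum>i\<in>I. F (\<phi> i x)\<bar> \<le> (\<Sum>i\<in>I. C)"
    by (rule order_trans[OF sum_abs]) (intro sum_mono assms)
  thus ?thesis using card_pos by (simp add: transfer_def field_simps)
qed

lemma transfer_iter: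
  assumes "continuous_on UNIV F" "\<And>x. \<bar>F x\<bar> \<le> C"
  shows "continuous_on UNIV ((transfer ^^ k) F)" "\<And>x. \<bar>(transfer ^^ k) F x\<bar> \<le> C"
proof -
  have "continuous_on UNIV ((transfer ^^ k) F) \<and> (\<forall>x. \<bar>(transfer ^^ k) F x\<bar> \<le> C)"
    by (induction k) (use assms continuous_transfer transfer_bound in auto)
  thus "continuous_on UNIV ((transfer ^^ k) F)" "\<And>x. \<bar>(transfer ^^ k) F x\<bar> \<le> C" by auto
qed

text \<open>
  The equation for invariant measures says that \<open>M\<close> is the mixture of its images under the maps
  \<open>\<phi> i\<close>; integrating over the mixture is integrating the transferred function.
\<close>
lemma integral_transfer:
  assumes M: "invariant_prob Y M" and F: "continuous_on UNIV F" "\<And>x. \<bar>F x\<bar> \<le> C"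
  shows "(\<integral>x. transfer F x \<partial>M) = (\<integral>x. F x \<partial>M)"
proof -
  interpret M: prob_space M using M by (simp add: invariant_prob_def)
  have sM[measurable_cong]: "sets M = sets borel" using M by (simp add: invariant_prob_def)
  have spM: "space M = UNIV" using sets_eq_imp_space_eq[OF sM] by simp
  have [measurable]: "F \<in> borel_measurable borel" by (rule borel_measurable_continuous_onI[OF F(1)])
  \<comment> \<open>Outside \<open>I\<close> nothing is known about \<open>\<phi>\<close>, not even measurability, but the kernel is a total function.\<close>
  define \<psi> where "\<psi> = (\<lambda>i. if i \<in> I then \<phi> i else id)"
  have \<psi>[measurable]: "\<psi> i \<in> borel_measurable borel" for i
    unfolding \<psi>_def using continuous_phi[of i UNIV] by (auto intro: borel_measurable_continuous_onI)
  define K where "K = (\<lambda>i. distr M borel (\<psi> i))"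
  have Kprob: "prob_space (K i)" for i
    unfolding K_def by (rule M.prob_space_distr) measurable
  have K: "K \<in> measurable (measure_pmf (pmf_of_set I)) (subprob_algebra borel)"
    unfolding measurable_pmf_measure1 K_def
    by (auto simp: space_subprob_algebra intro!: prob_space_imp_subprob_space M.prob_space_distr)
  have "M = measure_pmf (pmf_of_set I) \<bind> K"
  proof (rule measure_eqI)
    show "sets M = sets (measure_pmf (pmf_of_set I) \<bind> K)"
      by (subst sets_bind[of _ _ borel]) (auto simp: K_def sM)
    fix X assume X: "X \<in> sets M"
    hence Xb: "X \<in> sets borel" by (simp add: sM)
    have Kp: "emeasure (K i) X = ennreal (measure M (\<phi> i -` X))" if "i \<in> I" for i
      using that Xb \<psi>[of i] by (simp add: K_def emeasure_distr spM M.emeasure_eq_measure \<psi>_def)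
    have "emeasure (measure_pmf (pmf_of_set I) \<bind> K) X
        = (\<Sum>i\<in>I. emeasure (K i) X) / card I"
      using Xb fin ne by (subst emeasure_bind[OF _ K]) (auto simp: nn_integral_pmf_of_set)
    also have "\<dots> = (\<Sum>i\<in>I. ennreal (measure M (\<phi> i -` X))) / card I" using Kp by simp
    also have "\<dots> = ennreal ((\<Sum>i\<in>I. measure M (\<phi> i -` X)) / card I)"
      using card_pos by (simp add: sum_ennreal divide_ennreal sum_nonneg ennreal_of_nat_eq_real_of_nat)
    also have "\<dots> = emeasure M X" using M Xb by (simp add: invariant_prob_def M.emeasure_eq_measure)
    finally show "emeasure M X = emeasure (measure_pmf (pmf_of_set I) \<bind> K) X" by simp
  qed
  hence "(\<integral>x. F x \<partial>M) = (\<integral>x. F x \<partial>(measure_pmf (pmf_of_set I) \<bind> K))" by simp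
  also have "\<dots> = (\<integral>i. (\<integral>x. F x \<partial>K i) \<partial>measure_pmf (pmf_of_set I))"
    by (rule integral_bind[OF _ _ K, where B = C and B' = 1])
       (use F(2) Kprob[THEN prob_space.emeasure_space_1] in \<open>simp_all add: measure_pmf.finite_measure_axioms\<close>)
  also have "\<dots> = (\<Sum>i\<in>I. \<integral>x. F x \<partial>K i) / card I" using fin ne by (simp add: integral_pmf_of_set)
  also have "\<dots> = (\<Sum>i\<in>I. \<integral>x. F (\<phi> i x) \<partial>M) / card I"
    unfolding K_def by (simp add: integral_distr) (simp add: \<psi>_def)
  also have "\<dots> = (\<integral>x. transfer F x \<partial>M)"
  proof -
    have "integrable M (\<lambda>x. F (\<phi> i x))" if "i \<in> I" for i
    proof (rule M.integrable_const_bound[where B = C])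
      show "(\<lambda>x. F (\<phi> i x)) \<in> borel_measurable M" using \<psi>[of i] that by (simp add: \<psi>_def)
    qed (use F(2) in auto)
    thus ?thesis unfolding transfer_def by (simp add: Bochner_Integration.integral_sum)
  qed
  finally show ?thesis ..
qed

lemma attractor_map: "is_attractor Y \<Longrightarrow> i \<in> I \<Longrightarrow> y \<in> Y \<Longrightarrow> \<phi> i y \<in> Y"
  by (auto simp: is_attractor_def hutchinson_def)

text \<open>
  Every transfer shrinks arguments by the factor \<open>r\<close>, so a modulus of continuity that holds for \<open>F\<close>
  at scale \<open>d\<close> holds for the \<open>k\<close>-th transfer at scale \<open>d / r ^ k\<close>, which finally exceeds the
  diameter of the attractor. The bound involves no measure, so one \<open>k\<close> serves for all of them.
\<close>
lemma transfer_oscillation: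
  assumes Y: "is_attractor Y" and F: "continuous_on UNIV F" and e: "e > 0"
  shows "\<exists>k. \<forall>p\<in>Y. \<forall>y\<in>Y. \<bar>(transfer ^^ k) F p - (transfer ^^ k) F y\<bar> \<le> e"
proof -
  have cY: "compact Y" using Y by (simp add: is_attractor_def)
  have "uniformly_continuous_on Y F"
    using cY by (intro compact_uniformly_continuous continuous_on_subset[OF F]) auto
  then obtain d where d: "d > 0" "\<And>u v. u \<in> Y \<Longrightarrow> v \<in> Y \<Longrightarrow> dist u v < d \<Longrightarrow> dist (F u) (F v) < e"
    unfolding uniformly_continuous_on_def using e by metis
  \<comment> \<open>The scale is written as a product because \<open>r\<close> may be zero.\<close>
  have osc: "\<forall>u\<in>Y. \<forall>v\<in>Y. r ^ k * dist u v < d \<longrightarrow> \<bar>(transfer ^^ k) F u - (transfer ^^ k) F v\<bar> \<le> e" for k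
  proof (induction k)
    case 0
    show ?case using d(2) by (auto simp: dist_real_def less_imp_le)
  next
    case (Suc k)
    show ?case
    proof (intro ballI impI)
      fix u v assume uv: "u \<in> Y" "v \<in> Y" "r ^ Suc k * dist u v < d"
      let ?G = "(transfer ^^ k) F"
      have "\<bar>?G (\<phi> i u) - ?G (\<phi> i v)\<bar> \<le> e" if i: "i \<in> I" for i
      proof -
        have "r ^ k * dist (\<phi> i u) (\<phi> i v) \<le> r ^ k * (r * dist u v)"
          using contr[OF i] r by (intro mult_left_mono) auto
        also have "\<dots> < d" using uv(3) by (simp add: mult_ac)
        finally show ?thesis using Suc attractor_map[OF Y i] uv by blast
      qed
      hence "\<bar>\<Sum>i\<in>I. ?G (\<phi> i u) - ?G (\<phi> i v)\<bar> \<le> (\<Sum>i\<in>I. e)"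
        by (intro order_trans[OF sum_abs] sum_mono)
      hence "\<bar>(\<Sum>i\<in>I. ?G (\<phi> i u)) - (\<Sum>i\<in>I. ?G (\<phi> i v))\<bar> / card I \<le> e"
        using card_pos by (simp add: sum_subtractf field_simps)
      thus "\<bar>(transfer ^^ Suc k) F u - (transfer ^^ Suc k) F v\<bar> \<le> e"
        using card_pos by (simp add: transfer_def diff_divide_distrib[symmetric])
    qed
  qed
  obtain D where D: "\<And>u v. u \<in> Y \<Longrightarrow> v \<in> Y \<Longrightarrow> dist u v \<le> D"
    using compact_imp_bounded[OF cY] unfolding bounded_two_points by metis
  have "(\<lambda>k. r ^ k * D) \<longlonglongrightarrow> 0 * D" using r by (intro tendsto_intros LIMSEQ_realpow_zero) auto
  hence "\<forall>\<^sub>F k in sequentially. r ^ k * D < d" using d(1) by (intro order_tendstoD) auto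
  then obtain k where k: "r ^ k * D < d" by (auto simp: eventually_sequentially)
  have "\<bar>(transfer ^^ k) F p - (transfer ^^ k) F y\<bar> \<le> e" if "p \<in> Y" "y \<in> Y" for p y
  proof -
    have "r ^ k * dist p y \<le> r ^ k * D" using D[OF that] r by (intro mult_left_mono) auto
    thus ?thesis using osc[of k] that k by auto
  qed
  thus ?thesis by blast
qed

text \<open>
  The transfers of \<open>F\<close> keep the integral of \<open>F\<close>, and a function that is nearly constant on a set of
  full measure is there near its integral.
\<close>
lemma transfer_near_integral:
  assumes Y: "is_attractor Y" and M: "invariant_prob Y M"
    and F: "continuous_on UNIV F" "\<And>x. \<bar>F x\<bar> \<le> C"
    and close: "\<And>p y. p \<in> Y \<Longrightarrow> y \<in> Y \<Longrightarrow> \<bar>(transfer ^^ k) F p - (transfer ^^ k) F y\<bar> \<le> e"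
    and p: "p \<in> Y"
  shows "\<bar>(transfer ^^ k) F p - (\<integral>x. F x \<partial>M)\<bar> \<le> e"
proof -
  interpret M: prob_space M using M by (simp add: invariant_prob_def)
  have sM[measurable_cong]: "sets M = sets borel" using M by (simp add: invariant_prob_def)
  have cY: "compact Y" using Y by (simp add: is_attractor_def)
  let ?G = "(transfer ^^ k) F"
  have intG: "(\<integral>x. (transfer ^^ n) F x \<partial>M) = (\<integral>x. F x \<partial>M)" for n
    by (induction n) (use integral_transfer[OF M transfer_iter[OF F]] in auto)
  have [measurable]: "?G \<in> borel_measurable borel"
    by (rule borel_measurable_continuous_onI[OF transfer_iter(1)[OF F]])
  have iG: "integrable M ?G"
    by (rule M.integrable_const_bound[where B = C]) (use transfer_iter(2)[OF F] in auto)
  have "AE y in M. y \<in> Y"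
    using M cY M.prob_eq_1[of Y] by (simp add: invariant_prob_def sM compact_imp_closed)
    have AEc: "AE y in M. norm (?G p - ?G y) \<le> e" using \<open>AE y in M. y \<in> Y\<close> close[OF p] by auto
    have "?G p - (\<integral>x. F x \<partial>M) = (\<integral>y. ?G p - ?G y \<partial>M)"
      using iG intG by (simp add: M.prob_space)
    also have "\<bar>\<dots>\<bar> \<le> (\<integral>y. norm (?G p - ?G y) \<partial>M)"
      using integral_norm_bound[of M "\<lambda>y. ?G p - ?G y"] by simp
    also have "\<dots> \<le> (\<integral>y. e \<partial>M)" using AEc iG by (intro integral_mono_AE) auto
    finally show ?thesis by (simp add: M.prob_space)
qed

text \<open>
  The values of a transfer of \<open>F\<close> at a single point of the attractor approximate the integral of
  \<open>F\<close> for either measure.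
\<close>
lemma invariant_prob_unique:
  assumes Y: "is_attractor Y" and M: "invariant_prob Y M" and N: "invariant_prob Y N"
  shows "M = N"
proof (rule borel_prob_eqI)
  fix F :: "'a \<Rightarrow> real" assume F: "continuous_on UNIV F" "\<And>x. \<bar>F x\<bar> \<le> 1"
  obtain p where p: "p \<in> Y" using Y by (auto simp: is_attractor_def)
  have "\<bar>(\<integral>x. F x \<partial>M) - (\<integral>x. F x \<partial>N)\<bar> \<le> 0 + e" if e: "e > 0" for e
  proof -
    obtain k where k: "\<And>p y. p \<in> Y \<Longrightarrow> y \<in> Y \<Longrightarrow> \<bar>(transfer ^^ k) F p - (transfer ^^ k) F y\<bar> \<le> e / 2"
      using transfer_oscillation[OF Y F(1), of "e / 2"] e by auto
    show ?thesis
      using transfer_near_integral[OF Y M F k p] transfer_near_integral[OF Y N F k p] by linarith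
  qed
  hence "\<bar>(\<integral>x. F x \<partial>M) - (\<integral>x. F x \<partial>N)\<bar> \<le> 0" by (rule field_le_epsilon)
  thus "(\<integral>x. F x \<partial>M) = (\<integral>x. F x \<partial>N)" by simp
qed (use M N in \<open>auto simp: invariant_prob_def\<close>)

text \<open>
  Draw an infinite sequence of indices independently and uniformly, and send it to the limit of
  the compositions of the corresponding maps. Prepending an index applies the corresponding map to the
  limit, so the distribution of the limit is invariant.
\<close>
lemma invariant_prob_exists:
  assumes Y: "is_attractor Y"
  shows "\<exists>M. invariant_prob Y M"
proof -
  obtain i0 where i0: "i0 \<in> I" using ne by blast
  obtain y0 where y0: "y0 \<in> Y" using Y by (auto simp: is_attractor_def)
  have cY: "compact Y" using Y by (simp add: is_attractor_def)
  \<comment> \<open>Letters outside \<open>I\<close> have probability zero; reading them as \<open>i0\<close> avoids exceptional sequences.\<close>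
  define \<psi> where "\<psi> = (\<lambda>i. \<phi> (if i \<in> I then i else i0))"
  have \<psi>_contr: "dist (\<psi> i x) (\<psi> i y) \<le> r * dist x y" for i x y
    unfolding \<psi>_def by (rule contr) (use i0 in auto)
  have \<psi>_Y: "\<psi> i y \<in> Y" if "y \<in> Y" for i y
    unfolding \<psi>_def by (rule attractor_map[OF Y]) (use i0 that in auto)
  have \<psi>_cont: "continuous_on UNIV (\<psi> i)" for i
    unfolding \<psi>_def by (rule continuous_phi) (use i0 in auto)
  define point where "point = (\<lambda>k. rec_nat (\<lambda>w. y0) (\<lambda>_ f w. \<psi> (shd w) (f (stl w))) k)"
  have point: "point 0 w = y0" "point (Suc k) w = \<psi> (shd w) (point k (stl w))" for k w
    by (simp_all add: point_def)
  have point_Y: "point k w \<in> Y" for k w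
    by (induction k arbitrary: w) (simp_all add: point y0 \<psi>_Y)
  obtain D where D: "\<And>u v. u \<in> Y \<Longrightarrow> v \<in> Y \<Longrightarrow> dist u v \<le> D"
    using compact_imp_bounded[OF cY] unfolding bounded_two_points by metis
  have near: "dist (point (k + m) w) (point k w) \<le> r ^ k * D" for k m w
  proof (induction k arbitrary: w)
    case 0
    show ?case using D[OF point_Y point_Y] by simp
  next
    case (Suc k)
    have "dist (point (Suc k + m) w) (point (Suc k) w) \<le> r * dist (point (k + m) (stl w)) (point k (stl w))"
      by (simp add: point \<psi>_contr)
    also have "\<dots> \<le> r * (r ^ k * D)" using Suc r by (intro mult_left_mono) auto
    finally show ?case by simp
  qed
  have rD: "(\<lambda>k. r ^ k * D) \<longlonglongrightarrow> 0"
    using tendsto_mult_right[OF LIMSEQ_realpow_zero[of r], of D] r by simp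
  have conv: "convergent (\<lambda>k. point k w)" for w
  proof (rule Cauchy_convergent, rule metric_CauchyI)
    fix e :: real assume "e > 0"
    hence "\<forall>\<^sub>F k in sequentially. r ^ k * D < e / 2" using rD by (intro order_tendstoD) auto
    then obtain k where k: "r ^ k * D < e / 2" by (auto simp: eventually_sequentially)
    have "dist (point m w) (point n w) < e" if "m \<ge> k" "n \<ge> k" for m n
      using near[of k "m - k" w] near[of k "n - k" w] that k
        dist_triangle2[of "point m w" "point n w" "point k w"] by simp
    thus "\<exists>k. \<forall>m\<ge>k. \<forall>n\<ge>k. dist (point m w) (point n w) < e" by blast
  qed
  define \<pi> where "\<pi> = (\<lambda>w. lim (\<lambda>k. point k w))"
  have lim: "(\<lambda>k. point k w) \<longlonglongrightarrow> \<pi> w" for w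
    using conv unfolding \<pi>_def by (simp add: convergent_LIMSEQ_iff)
  have \<pi>_Y: "\<pi> w \<in> Y" for w
    by (rule closed_sequentially[OF compact_imp_closed[OF cY] _ lim]) (rule point_Y)
  have \<pi>_SCons: "\<pi> (a ## w) = \<psi> a (\<pi> w)" for a w
  proof -
    have "(\<lambda>k. point (Suc k) (a ## w)) \<longlonglongrightarrow> \<psi> a (\<pi> w)"
      using \<psi>_cont[of a] lim[of w]
      by (auto simp: point continuous_on_eq_continuous_at intro!: isCont_tendsto_compose[where g = "\<psi> a"])
    moreover have "(\<lambda>k. point (Suc k) (a ## w)) \<longlonglongrightarrow> \<pi> (a ## w)"
      using lim by (rule LIMSEQ_Suc)
    ultimately show ?thesis by (rule LIMSEQ_unique[rotated])
  qed
  define B where "B = measure_pmf (pmf_of_set I)"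
  define P where "P = stream_space B"
  interpret B: prob_space B unfolding B_def by (rule measure_pmf.prob_space_axioms)
  interpret P: prob_space P unfolding P_def by (rule B.prob_space_stream_space)
  have spP: "space P = UNIV" by (simp add: P_def B_def space_stream_space)
  have point_meas: "point k \<in> borel_measurable P" for k
  proof (induction k)
    case 0
    show ?case by (simp add: point(1)[abs_def])
  next
    case (Suc k)
    let ?c = "\<lambda>i. if i \<in> I then i else i0"
    have "(\<lambda>w. \<phi> (?c (shd w)) (point k (stl w))) \<in> borel_measurable P"
    proof (rule measurable_compose_countable'[where I = I and f = "\<lambda>i w. \<phi> i (point k (stl w))"])
      fix i assume i: "i \<in> I"
      have "stl \<in> measurable P P" unfolding P_def by measurable
      from measurable_compose[OF measurable_compose[OF this Suc] borel_measurable_continuous_onI[OF continuous_phi[OF i]]]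
      show "(\<lambda>w. \<phi> i (point k (stl w))) \<in> borel_measurable P" .
    next
      have shd: "shd \<in> measurable P (count_space UNIV)"
        using measurable_shd[of B] unfolding P_def B_def by (simp add: measurable_def)
      have "?c \<in> measurable (count_space UNIV) (count_space I)" using i0 by simp
      from measurable_compose[OF shd this]
      show "(\<lambda>w. ?c (shd w)) \<in> measurable P (count_space I)" .
    qed (use fin in \<open>simp add: countable_finite\<close>)
    thus ?case by (simp add: point(2)[abs_def] \<psi>_def)
  qed
  have \<pi>_meas[measurable]: "\<pi> \<in> borel_measurable P"
    by (rule borel_measurable_LIMSEQ_metric[OF point_meas lim])
  define M where "M = distr P borel \<pi>"
  interpret M: prob_space M unfolding M_def by (rule P.prob_space_distr) simp
  have emM: "emeasure M X = emeasure P {w. \<pi> w \<in> X}" if "X \<in> sets borel" for X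
    using that by (simp add: M_def emeasure_distr spP vimage_def)
  have "measure M Y = 1"
    using emM[of Y] \<pi>_Y cY P.emeasure_space_1
    by (simp add: compact_imp_closed M.emeasure_eq_measure spP)
  moreover have "measure M X = (\<Sum>i\<in>I. measure M (\<phi> i -` X)) / real (card I)"
    if X: "X \<in> sets borel" for X
  proof -
    have vim: "\<phi> i -` X \<in> sets borel" if "i \<in> I" for i
      using measurable_sets[OF borel_measurable_continuous_onI[OF continuous_phi[OF that, of UNIV]] X] by simp
    have "{w. \<pi> w \<in> X} \<in> sets P" using measurable_sets[OF \<pi>_meas X] spP by (simp add: vimage_def)
    hence "emeasure P {w. \<pi> w \<in> X} = (\<integral>\<^sup>+ a. emeasure P {w. \<psi> a (\<pi> w) \<in> X} \<partial>B)"
      using B.emeasure_stream_space[of "{w. \<pi> w \<in> X}"] spP by (simp add: P_def \<pi>_SCons)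
    also have "\<dots> = (\<Sum>a\<in>I. emeasure P {w. \<psi> a (\<pi> w) \<in> X}) / card I"
      using fin ne by (simp add: B_def nn_integral_pmf_of_set)
    also have "(\<Sum>a\<in>I. emeasure P {w. \<psi> a (\<pi> w) \<in> X}) = (\<Sum>a\<in>I. emeasure M (\<phi> a -` X))"
      by (intro sum.cong refl) (simp add: emM[OF vim] \<psi>_def)
    also have "\<dots> / card I = ennreal ((\<Sum>i\<in>I. measure M (\<phi> i -` X)) / card I)"
      using card_pos by (simp add: M.emeasure_eq_measure sum_ennreal divide_ennreal sum_nonneg ennreal_of_nat_eq_real_of_nat)
    finally show ?thesis
      using emM[OF X] by (simp add: M.emeasure_eq_measure sum_nonneg)
  qed
  ultimately have "invariant_prob Y M"
    using M.prob_space_axioms by (simp add: invariant_prob_def) (simp add: M_def)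
  thus ?thesis ..
qed

end

section \<open>Linear inequalities over the golden field\<close>

lemma golden_bounds: "8 / 5 < golden" "golden < 5 / 3"
proof -
  have "sqrt 5 > 11/5" by (rule real_less_rsqrt) (simp add: power2_eq_square)
  moreover have "sqrt 5 < 7/3" by (rule real_less_lsqrt) (simp_all add: power2_eq_square)
  ultimately show "8 / 5 < golden" "golden < 5 / 3" by (auto simp: golden_def)
qed

lemma golden_mult: "golden * golden = golden + 1" "golden * (golden * x) = golden * x + x"
  using golden_sq by (simp_all add: power2_eq_square distrib_right mult.assoc[symmetric])

lemma divide_golden: "x / golden = golden * x - x"
  using golden_mult(1) golden_pos by (simp add: field_simps golden_mult)

lemma divide_golden_sq: "x / golden\<^sup>2 = 2 * x - golden * x"
proof -
  have "x / golden\<^sup>2 = x / golden / golden" by (simp add: power2_eq_square)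
  also have "\<dots> = 2 * x - golden * x" by (simp only: divide_golden) (simp add: algebra_simps golden_mult)
  finally show ?thesis .
qed

text \<open>
  Linear arithmetic over the rationals treats \<open>s\<close> and \<open>golden * s\<close> as unrelated unknowns, so a
  positive factor from the golden field is invisible to it. Multiplying an inequality by the small
  positive numbers \<open>5 - 3 * golden\<close> and \<open>5 * golden - 8\<close> repairs this: they are nearly
  the extreme rays of the cone of positive elements \<open>a + golden * b\<close>, so that all the factors that
  occur below are nonnegative rational combinations of these two.
\<close>
lemma golden_linear:
  "a + golden * b \<ge> 0 \<Longrightarrow>
     a + golden * b \<ge> 0 \<and> (5 * a - 3 * b) + golden * (2 * b - 3 * a) \<ge> 0 \<and>
     (5 * b - 8 * a) + golden * (5 * a - 3 * b) \<ge> 0"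
  "a + golden * b > 0 \<Longrightarrow>
     a + golden * b > 0 \<and> (5 * a - 3 * b) + golden * (2 * b - 3 * a) > 0 \<and>
     (5 * b - 8 * a) + golden * (5 * a - 3 * b) > 0"
proof -
  have *: "(5 - 3 * golden) * (a + golden * b) = (5 * a - 3 * b) + golden * (2 * b - 3 * a)"
   "(5 * golden - 8) * (a + golden * b) = (5 * b - 8 * a) + golden * (5 * a - 3 * b)"
    by (simp_all add: algebra_simps golden_mult)
  have p: "5 - 3 * golden > 0" "5 * golden - 8 > 0" using golden_bounds by auto
  show "a + golden * b \<ge> 0 \<Longrightarrow>
     a + golden * b \<ge> 0 \<and> (5 * a - 3 * b) + golden * (2 * b - 3 * a) \<ge> 0 \<and>
     (5 * b - 8 * a) + golden * (5 * a - 3 * b) \<ge> 0"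
    using *[symmetric] p by simp
  show "a + golden * b > 0 \<Longrightarrow>
     a + golden * b > 0 \<and> (5 * a - 3 * b) + golden * (2 * b - 3 * a) > 0 \<and>
     (5 * b - 8 * a) + golden * (5 * a - 3 * b) > 0"
    using *[symmetric] p by simp
qed

section \<open>The return map in oblique coordinates\<close>

definition oblique :: "real \<Rightarrow> real \<Rightarrow> complex" where
  "oblique s t = of_real s - of_real t * inverse zeta5"

text \<open>
  The trapezium of oblique coordinates of the points of the return domain. The lower bound
  \<open>s / golden < t\<close> is written without division, since \<open>1 / golden = golden - 1\<close>.
\<close>
definition ret_coord :: "real \<Rightarrow> real \<Rightarrow> bool" where
  "ret_coord s t \<longleftrightarrow> 0 \<le> s \<and> s < 1 \<and> t < 1 \<and> golden * s - s < t"

definition ret_dom :: "complex set" where "ret_dom = piso ` dom_Z"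

lemma oblique_inj: "oblique s t = oblique s' t' \<longleftrightarrow> s = s' \<and> t = t'"
  unfolding oblique_def by (rule pt_inj)

lemma ret_coord_pos: "ret_coord s t \<Longrightarrow> 0 < t"
  using golden_pos(2) mult_right_mono[of 1 golden s] by (simp add: ret_coord_def)

lemma oblique_ret_dom: "oblique s t \<in> ret_dom \<longleftrightarrow> ret_coord s t"
  using ret_coord_pos[of s t] by (auto simp: ret_dom_def oblique_def pt_in_piso_Z ret_coord_def divide_golden)

lemma ret_domE:
  assumes "x \<in> ret_dom" obtains s t where "x = oblique s t" "ret_coord s t"
proof -
  from assms have "x \<in> dom_L"
    using bij_betw_imp_surj_on[OF piso_bij] by (auto simp: ret_dom_def dom_Z_def)
  then obtain s t where "x = oblique s t" by (auto simp: dom_L_def oblique_def)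
  with assms that show ?thesis by (simp add: oblique_ret_dom)
qed

text \<open>
  On points on or above the line \<open>s = t / golden\<close> the return takes two steps of \<open>piso\<close>, and one step
  elsewhere. Both branches are affine in the coordinates.
\<close>
lemma ret_steep:
  assumes "ret_coord s t" "s \<le> golden * t - t"
  shows "piso_ret (oblique s t) = oblique (golden * t - t - s) (1 - (golden * (s + t) - (s + t)))"
proof -
  have b: "0 \<le> s" "s < 1" "t < 1" "golden * s - s < t" "0 < t" using assms ret_coord_pos by (auto simp: ret_coord_def)
  have D: "oblique s t \<in> dom_Delta" using b assms by (simp add: oblique_def pt_in_Delta divide_golden)
  have 1: "piso (oblique s t) = oblique t (golden * t - t - s)"
    using b assms unfolding oblique_def by (subst piso_pt) (auto simp: divide_golden)
  have u: "golden * t < 2 * t" using b golden_bounds by simp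
  have *: "golden * (golden * t - t - s) = t - golden * s" by (simp add: algebra_simps golden_mult)
  have gs: "golden * (s + t) > s + t" "golden * t < 1 + s + t"
    using b golden_pos(2) mult_strict_right_mono[OF golden_bounds(2) b(5)] by (simp, linarith)
  have "piso (oblique t (golden * t - t - s)) = oblique (golden * t - t - s) (1 - (golden * (s + t) - (s + t)))"
    unfolding oblique_def
    by (subst piso_pt) (use b assms(2) * gs in \<open>auto simp: divide_golden algebra_simps golden_mult\<close>)
  with D 1 show ?thesis
    by (subst piso_ret_explicit) (use assms(1) oblique_ret_dom ret_dom_def in auto)
qed

lemma ret_flat:
  assumes "ret_coord s t" "golden * t - t < s"
  shows "piso_ret (oblique s t) = oblique t (golden * t - t - s + 1)"
proof -
  have b: "0 \<le> s" "s < 1" "t < 1" "golden * s - s < t" "0 < t" using assms ret_coord_pos by (auto simp: ret_coord_def)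
  have D: "oblique s t \<notin> dom_Delta" using b assms by (simp add: oblique_def pt_in_Delta divide_golden)
  have 1: "piso (oblique s t) = oblique t (golden * t - t - s + 1)"
    using b assms unfolding oblique_def by (subst piso_pt) (auto simp: divide_golden)
  with D 1 show ?thesis
    by (subst piso_ret_explicit) (use assms(1) oblique_ret_dom ret_dom_def in auto)
qed

definition shrink :: "nat \<Rightarrow> complex \<Rightarrow> complex" where
  "shrink m x = zeta5 ^ m / of_real (golden\<^sup>2) * x + ifs_d m"

lemma oblique_divide: "oblique s t / zeta5 = oblique t (golden * t - t - s)"
  unfolding oblique_def by (simp add: pt_div divide_golden)

lemma oblique_scale: "of_real c * oblique s t = oblique (c * s) (c * t)"
  by (simp add: oblique_def algebra_simps)

lemma oblique_add: "oblique s t + oblique s' t' = oblique (s + s') (t + t')"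
  by (simp add: oblique_def algebra_simps)

lemma zeta5_power5: "zeta5 ^ 5 = 1"
proof -
  have "zeta5 ^ 5 = cis (real 5 * (2 * pi / 5))" unfolding zeta5_cis by (rule Complex.DeMoivre)
  also have "real 5 * (2 * pi / 5) = 2 * pi" by simp
  finally show ?thesis by simp
qed

lemma oblique_mult: "zeta5 * oblique s t = oblique (golden * s - s - t) s"
proof -
  have "oblique (golden * s - s - t) s / zeta5 = oblique s t" by (simp add: oblique_divide)
  thus ?thesis by (simp add: zeta5_def field_simps)
qed

text \<open>
  Multiplication by \<open>zeta5\<close> is the linear map \<open>(s, t) \<mapsto> (s / golden - t, s)\<close>, and the translations
  are multiples of powers of \<open>zeta5\<close>.
\<close>
lemma shrink_oblique:
  "shrink 0 (oblique s t) = oblique (2 * s - golden * s) (2 * t - golden * t)"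
  "shrink 5 (oblique s t) = oblique (2 * s - golden * s) (2 * t - golden * t + golden - 1)"
  "shrink 3 (oblique s t) = oblique (golden * (2 * t + s - 1) - 3 * t - 2 * s + 2)
     (golden * (1 - 2 * (s + t)) - 1 + 3 * (s + t))"
  "shrink 2 (oblique s t) = oblique (golden * (1 - 2 * (s + t)) - 1 + 3 * (s + t))
     (golden * (2 * s + t) - 3 * s - 2 * t + 1)"
proof -
  have s: "shrink m (oblique s t) = of_real (1 / golden\<^sup>2) * (zeta5 ^ m * oblique s t) + ifs_d m" for m
    by (simp add: shrink_def)
  have one: "1 = oblique 1 0" by (simp add: oblique_def)
  have d3: "ifs_d 3 = of_real (1 / golden) * (zeta5 * oblique 1 0)"
    by (simp add: ifs_d_def one[symmetric])
  have d2: "ifs_d 2 = zeta5 * oblique 1 0" by (simp add: ifs_d_def one[symmetric])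
  have d5: "ifs_d 5 = of_real (- 1 / golden) * (oblique 1 0 / zeta5)"
    by (simp add: ifs_d_def one[symmetric])
  have p: "zeta5 ^ 2 * x = zeta5 * (zeta5 * x)" "zeta5 ^ 3 * x = zeta5 * (zeta5 * (zeta5 * x))" for x
    by (simp_all add: power2_eq_square power3_eq_cube)
  show "shrink 0 (oblique s t) = oblique (2 * s - golden * s) (2 * t - golden * t)"
    by (simp only: s oblique_scale power_0 mult_1_left) (simp add: divide_golden_sq ifs_d_def oblique_inj algebra_simps)
  show "shrink 5 (oblique s t) = oblique (2 * s - golden * s) (2 * t - golden * t + golden - 1)"
    by (simp only: s d5 zeta5_power5 mult_1_left oblique_scale oblique_divide oblique_add)
       (simp add: oblique_inj divide_golden_sq divide_golden algebra_simps golden_mult)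
  show "shrink 3 (oblique s t) = oblique (golden * (2 * t + s - 1) - 3 * t - 2 * s + 2)
     (golden * (1 - 2 * (s + t)) - 1 + 3 * (s + t))"
    by (simp only: s d3 p oblique_scale oblique_mult oblique_add)
       (simp add: oblique_inj divide_golden_sq divide_golden algebra_simps golden_mult)
  show "shrink 2 (oblique s t) = oblique (golden * (1 - 2 * (s + t)) - 1 + 3 * (s + t))
     (golden * (2 * s + t) - 3 * s - 2 * t + 1)"
    by (simp only: s d2 p oblique_scale oblique_mult oblique_add)
       (simp add: oblique_inj divide_golden_sq divide_golden algebra_simps golden_mult)
qed

text \<open>
  The inequalities that define the trapezium, followed by their products with \<open>5 - 3 * golden\<close> and
  \<open>5 * golden - 8\<close>, in the form that linear arithmetic can use.
\<close>
lemma ret_coord_golden: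
  assumes "ret_coord s t"
  shows "s \<ge> 0" "1 - s > 0" "1 - t > 0" "s - golden * s + t > 0"
    "5 * s - 3 * (golden * s) \<ge> 0" "5 * (golden * s) - 8 * s \<ge> 0"
    "5 - 3 * golden - 5 * s + 3 * (golden * s) > 0" "5 * golden - 8 - 5 * (golden * s) + 8 * s > 0"
    "5 - 3 * golden - 5 * t + 3 * (golden * t) > 0" "5 * golden - 8 - 5 * (golden * t) + 8 * t > 0"
    "8 * s + 5 * t - 5 * (golden * s) - 3 * (golden * t) > 0"
    "8 * (golden * s) + 5 * (golden * t) - 13 * s - 8 * t > 0"
  using golden_linear(1)[of s 0] golden_linear(2)[of "1 - s" 0] golden_linear(2)[of "1 - t" 0]
    golden_linear(2)[of "s + t" "- s"] assms
  by (simp_all add: ret_coord_def algebra_simps)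

lemma shrink_ret_coord:
  assumes "ret_coord s t"
  shows "ret_coord (2 * s - golden * s) (2 * t - golden * t)"
    "ret_coord (2 * s - golden * s) (2 * t - golden * t + golden - 1)"
    "ret_coord (golden * (2 * t + s - 1) - 3 * t - 2 * s + 2) (golden * (1 - 2 * (s + t)) - 1 + 3 * (s + t))"
    "ret_coord (golden * (1 - 2 * (s + t)) - 1 + 3 * (s + t)) (golden * (2 * s + t) - 3 * s - 2 * t + 1)"
  using ret_coord_golden[OF assms] golden_bounds
  unfolding ret_coord_def by (simp_all add: algebra_simps golden_mult)

lemma steep_or_flat:
  fixes s t :: real
  obtains "s \<le> golden * t - t" | "golden * t - t < s"
  by linarith

lemma steep_golden:
  assumes "s \<le> golden * t - t"
  shows "golden * t - s - t \<ge> 0"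
    "3 * (golden * s) + 5 * (golden * t) - 5 * s - 8 * t \<ge> 0"
    "8 * s + 13 * t - 5 * (golden * s) - 8 * (golden * t) \<ge> 0"
  using golden_linear(1)[of "- s - t" t] assms
  by (simp_all add: algebra_simps)

lemma flat_golden:
  assumes "golden * t - t < s"
  shows "s + t - golden * t > 0"
    "5 * s + 8 * t - 3 * (golden * s) - 5 * (golden * t) > 0"
    "5 * (golden * s) + 8 * (golden * t) - 8 * s - 13 * t > 0"
  using golden_linear(2)[of "s + t" "- t"] assms
  by (simp_all add: algebra_simps)

lemma ret_coord_ret:
  assumes "ret_coord s t"
  shows "s \<le> golden * t - t \<Longrightarrow> ret_coord (golden * t - t - s) (1 - (golden * (s + t) - (s + t)))"
    "golden * t - t < s \<Longrightarrow> ret_coord t (golden * t - t - s + 1)"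
proof -
  show "s \<le> golden * t - t \<Longrightarrow> ret_coord (golden * t - t - s) (1 - (golden * (s + t) - (s + t)))"
    using ret_coord_golden[OF assms] golden_bounds ret_coord_pos[OF assms] steep_golden[of s t]
    unfolding ret_coord_def by (simp add: algebra_simps golden_mult)
  show "golden * t - t < s \<Longrightarrow> ret_coord t (golden * t - t - s + 1)"
    using ret_coord_golden[OF assms] golden_bounds ret_coord_pos[OF assms] flat_golden[of t s]
    unfolding ret_coord_def by (simp add: algebra_simps golden_mult)
qed

lemma piso_ret_in: "x \<in> ret_dom \<Longrightarrow> piso_ret x \<in> ret_dom"
proof (erule ret_domE)
  fix s t assume "x = oblique s t" "ret_coord s t"
  thus "piso_ret x \<in> ret_dom"
    using ret_steep[of s t] ret_flat[of s t] ret_coord_ret[of s t] by (metis not_le oblique_ret_dom)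
qed

lemma shrink_in: "x \<in> ret_dom \<Longrightarrow> m \<in> ifs_idx \<Longrightarrow> shrink m x \<in> ret_dom"
  by (erule ret_domE) (auto simp: ifs_idx_def shrink_oblique oblique_ret_dom dest: shrink_ret_coord)

text \<open>
  The renormalisation of the return map. The image of the trapezium under \<open>shrink 5\<close> lies in the
  two-step region, under \<open>shrink 3\<close> in the one-step region, under \<open>shrink 2\<close> in the two-step region
  again, and \<open>shrink 0\<close>, a scaling about the origin, preserves the line between the regions.
  With the branches known, all four relations are identities between affine maps.
\<close>
lemma ret_shrink:
  assumes "x \<in> ret_dom"
  shows "piso_ret (shrink 0 x) = shrink 5 (piso_ret x)"
    "piso_ret (shrink 5 x) = shrink 3 x"
    "piso_ret (shrink 3 x) = shrink 2 x"
    "piso_ret (shrink 2 x) = shrink 0 x"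
proof -
  obtain s t where x: "x = oblique s t" "ret_coord s t" using assms by (rule ret_domE)
  note b = ret_coord_golden[OF x(2)] ret_coord_pos[OF x(2)] golden_bounds
  note sb = shrink_ret_coord[OF x(2)]
  show "piso_ret (shrink 5 x) = shrink 3 x"
    unfolding x(1) shrink_oblique
    by (subst ret_steep[OF sb(2)]) (use b in \<open>simp_all add: oblique_inj algebra_simps golden_mult\<close>)
  show "piso_ret (shrink 3 x) = shrink 2 x"
    unfolding x(1) shrink_oblique
    by (subst ret_flat[OF sb(3)]) (use b in \<open>simp_all add: oblique_inj algebra_simps golden_mult\<close>)
  show "piso_ret (shrink 2 x) = shrink 0 x"
    unfolding x(1) shrink_oblique
    by (subst ret_steep[OF sb(4)]) (use b in \<open>simp_all add: oblique_inj algebra_simps golden_mult\<close>)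
  show "piso_ret (shrink 0 x) = shrink 5 (piso_ret x)"
  proof (cases "s \<le> golden * t - t")
    case True
    show ?thesis
      unfolding x(1) ret_steep[OF x(2) True] shrink_oblique
      by (subst ret_steep[OF sb(1)]) (use b steep_golden[OF True] in \<open>simp_all add: oblique_inj algebra_simps golden_mult\<close>)
  next
    case False
    hence F: "golden * t - t < s" by simp
    show ?thesis
      unfolding x(1) ret_flat[OF x(2) F] shrink_oblique
      by (subst ret_flat[OF sb(1)]) (use b flat_golden[OF F] in \<open>simp_all add: oblique_inj algebra_simps golden_mult\<close>)
  qed
qed

text \<open>
  If images from the two branches agreed, the single step of the one would start from the
  intermediate point of the two steps of the other, and that point lies below the trapezium.
\<close>
lemma ret_inj: "inj_on piso_ret ret_dom"
proof (rule inj_onI)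
  fix x y assume xy: "x \<in> ret_dom" "y \<in> ret_dom" "piso_ret x = piso_ret y"
  obtain s t where x: "x = oblique s t" "ret_coord s t" using xy(1) by (rule ret_domE)
  obtain s' t' where y: "y = oblique s' t'" "ret_coord s' t'" using xy(2) by (rule ret_domE)
  have mixed: False if "ret_coord a b" "ret_coord c d" "a \<le> golden * b - b" "golden * d - d < c"
     "piso_ret (oblique a b) = piso_ret (oblique c d)" for a b c d
  proof -
    have *: "golden * b - b - a = d" "1 - (golden * (a + b) - (a + b)) = golden * d - d - c + 1"
      using that by (simp_all add: ret_steep ret_flat oblique_inj)
    hence "b = c" by (simp add: algebra_simps golden_mult flip: *(1))
    with * that(1,2) show False by (simp add: ret_coord_def)
  qed
  have steep: "a = c \<and> b = d" if "golden * b - b - a = golden * d - d - c"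
     "golden * (a + b) - (a + b) = golden * (c + d) - (c + d)" for a b c d
  proof -
    have "(golden - 1) * (a + b) = (golden - 1) * (c + d)" using that(2) by (simp add: algebra_simps)
    hence s: "a + b = c + d" using golden_pos(2) by simp
    have "golden * b = golden * d" using that(1) s by linarith
    thus ?thesis using s golden_pos by simp
  qed
  show "x = y"
  proof (cases "s \<le> golden * t - t"; cases "s' \<le> golden * t' - t'")
    assume "s \<le> golden * t - t" "s' \<le> golden * t' - t'"
    thus ?thesis using xy(3) x y steep[of t s t' s'] by (simp add: ret_steep oblique_inj)
  next
    assume "s \<le> golden * t - t" "\<not> s' \<le> golden * t' - t'"
    thus ?thesis using mixed[of s t s' t'] x y xy(3) by simp
  next
    assume "\<not> s \<le> golden * t - t" "s' \<le> golden * t' - t'"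
    thus ?thesis using mixed[of s' t' s t] x y xy(3) by simp
  next
    assume "\<not> s \<le> golden * t - t" "\<not> s' \<le> golden * t' - t'"
    thus ?thesis using xy(3) x y by (auto simp: ret_flat oblique_inj)
  qed
qed

lemma ret_surj:
  assumes "y \<in> ret_dom" obtains x where "x \<in> ret_dom" "piso_ret x = y"
proof -
  obtain u v where y: "y = oblique u v" "ret_coord u v" using assms by (rule ret_domE)
  \<comment> \<open>The point \<open>(a, u)\<close> is the preimage by the one-step branch if it lies in the region of that
    branch; otherwise the two-step branch reaches \<open>(u, v)\<close> from \<open>(a / golden - u, a)\<close>.\<close>
  define a where "a = golden * u - u - v + 1"
  note b = ret_coord_golden[OF y(2)] ret_coord_pos[OF y(2)] golden_bounds
  show ?thesis
  proof (cases "golden * a - a < u")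
    case True
    have "ret_coord a u" using b True unfolding ret_coord_def a_def by (simp add: algebra_simps golden_mult)
    moreover have "golden * u - u < a" using b unfolding a_def by simp
    ultimately show ?thesis
      by (intro that[of "oblique a u"]) (simp_all add: oblique_ret_dom ret_flat y oblique_inj, simp add: a_def)
  next
    case False
    have a: "0 < a" "a < 1" using b unfolding a_def by simp_all
    have ga: "golden * a < 2 * a" using a golden_bounds by simp
    have *: "ret_coord (golden * a - a - u) a"
      using a ga b False mult_strict_right_mono[OF golden_pos(2), of "a + u"] unfolding ret_coord_def
      by (simp add: algebra_simps golden_mult)
    have st: "golden * a - a - u \<le> golden * a - a" using b by simp
    show ?thesis
      by (intro that[of "oblique (golden * a - a - u) a"])
         (use * st in \<open>simp_all add: oblique_ret_dom ret_steep y oblique_inj\<close>, simp add: a_def algebra_simps golden_mult)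
  qed
qed

section \<open>Points outside the four copies are periodic\<close>

lemma shrink_inverse:
  "shrink 0 (oblique (golden * s + s) (golden * t + t)) = oblique s t"
  "shrink 5 (oblique (golden * s + s) (golden * t + t - golden)) = oblique s t"
  "shrink 3 (oblique (golden * (1 - s - t)) (golden * s + 1 - golden * t - t)) = oblique s t"
  "shrink 2 (oblique (golden * t - golden * s - s) (golden + 1 - golden * s - golden * t)) = oblique s t"
  by (simp_all add: shrink_oblique oblique_inj algebra_simps golden_mult)

text \<open>
  Passing from one branch of the return map to the other forces a point into one of the copies.
  The inverse similarities turn this into linear inequalities. The case distinction asks whether the
  first coordinate of the preimage under \<open>shrink 5\<close> is below one.
\<close>
lemma steep_then_flat_covered:
  assumes b: "ret_coord s t" and st: "s \<le> golden * t - t"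
    and fl: "golden * (1 - (golden * (s + t) - (s + t))) - (1 - (golden * (s + t) - (s + t))) < golden * t - t - s"
  shows "oblique s t \<in> shrink 5 ` ret_dom \<or> oblique s t \<in> shrink 2 ` ret_dom"
proof -
  note bg = ret_coord_golden[OF b]
  have "1 + s + t + golden * (- 1 - s) > 0"
    using fl by (simp add: algebra_simps golden_mult)
  from golden_linear(2)[OF this] have fl':
      "1 + (1) * s + (1) * t + (-1) * golden + (-1) * (golden * s) > 0"
      "8 + (8) * s + (5) * t + (-5) * golden + (-5) * (golden * s) + (-3) * (golden * t) > 0"
      "-13 + (-13) * s + (-8) * t + (8) * golden + (8) * (golden * s) + (5) * (golden * t) > 0"
    by (simp_all add: algebra_simps)
  show ?thesis
  proof (cases "1 - s + golden * (- s) > 0")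
    case True
    from golden_linear(2)[OF True] have T:
      "1 + (-1) * s + (-1) * (golden * s) > 0"
      "5 + (-2) * s + (-3) * golden + (1) * (golden * s) > 0"
      "-8 + (3) * s + (5) * golden + (-2) * (golden * s) > 0"
      by (simp_all add: algebra_simps)
    have "golden * s + s \<ge> 0" "golden * s + s < 1" "golden * t + t - golden < 1"
      "golden * s < golden * t + t - golden"
      using bg(1,5,6) bg(3,9,10) T(1) fl'(1,3) by linarith+
    hence "ret_coord (golden * s + s) (golden * t + t - golden)"
      by (simp add: ret_coord_def algebra_simps golden_mult)
    thus ?thesis using shrink_inverse(2)[of s t] oblique_ret_dom by (metis image_eqI)
  next
    case False
    hence "s - 1 + golden * s \<ge> 0" by simp
    from golden_linear(1)[OF this] have F:
      "-1 + (1) * s + (1) * (golden * s) >= 0"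
      "-5 + (2) * s + (3) * golden + (-1) * (golden * s) >= 0"
      "8 + (-3) * s + (-5) * golden + (2) * (golden * s) >= 0"
      by (simp_all add: algebra_simps)
    have "golden * t - golden * s - s \<ge> 0" "golden * t - golden * s - s < 1"
      "golden + 1 - golden * s - golden * t < 1" "t - golden * s < golden + 1 - golden * s - golden * t"
      using steep_golden(1,3)[OF st] bg(1,3,4,6,9,10,11,12) F(1) fl'(1) by linarith+
    hence "ret_coord (golden * t - golden * s - s) (golden + 1 - golden * s - golden * t)"
      by (simp add: ret_coord_def algebra_simps golden_mult)
    thus ?thesis using shrink_inverse(4)[of t s] oblique_ret_dom by (metis image_eqI)
  qed
qed

text \<open>
  The case distinction asks whether the first coordinate of the preimage under \<open>shrink 3\<close>
  is below one.
\<close>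
lemma flat_then_steep_covered:
  assumes b: "ret_coord s t" and st: "golden * t - t < s"
    and fl: "t \<le> golden * (golden * t - t - s + 1) - (golden * t - t - s + 1)"
  shows "oblique s t \<in> shrink 3 ` ret_dom \<or> oblique s t \<in> shrink 0 ` ret_dom"
proof -
  note bg = ret_coord_golden[OF b]
  have "- 1 + s + t + golden * (1 - s - t) \<ge> 0"
    using fl by (simp add: algebra_simps golden_mult)
  from golden_linear(1)[OF this] have fl':
      "-1 + (1) * s + (1) * t + (1) * golden + (-1) * (golden * s) + (-1) * (golden * t) >= 0"
      "-8 + (8) * s + (8) * t + (5) * golden + (-5) * (golden * s) + (-5) * (golden * t) >= 0"
      "13 + (-13) * s + (-13) * t + (-8) * golden + (8) * (golden * s) + (8) * (golden * t) >= 0"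
    by (simp_all add: algebra_simps)
  show ?thesis
  proof (cases "1 + golden * (s + t - 1) > 0")
    case True
    from golden_linear(2)[OF True] have T:
      "1 + (-1) * golden + (1) * (golden * s) + (1) * (golden * t) > 0"
      "8 + (-3) * s + (-3) * t + (-5) * golden + (2) * (golden * s) + (2) * (golden * t) > 0"
      "-13 + (5) * s + (5) * t + (8) * golden + (-3) * (golden * s) + (-3) * (golden * t) > 0"
      by (simp_all add: algebra_simps)
    have "golden - golden * s - golden * t \<ge> 0" "golden - golden * s - golden * t < 1"
      "golden * s + 1 - golden * t - t < 1"
      "1 - s - t < golden * s + 1 - golden * t - t"
      using bg(4,12) flat_golden(1,3)[OF st] T(1) fl'(1,3) by linarith+
    hence "ret_coord (golden * (1 - s - t)) (golden * s + 1 - golden * t - t)"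
      by (simp add: ret_coord_def algebra_simps golden_mult)
    thus ?thesis using shrink_inverse(3)[of s t] oblique_ret_dom by (metis image_eqI)
  next
    case False
    hence "- 1 + golden * (1 - s - t) \<ge> 0" by (simp add: algebra_simps)
    from golden_linear(1)[OF this] have F:
      "-1 + (1) * golden + (-1) * (golden * s) + (-1) * (golden * t) >= 0"
      "-8 + (3) * s + (3) * t + (5) * golden + (-2) * (golden * s) + (-2) * (golden * t) >= 0"
      "13 + (-5) * s + (-5) * t + (-8) * golden + (3) * (golden * s) + (3) * (golden * t) >= 0"
      by (simp_all add: algebra_simps)
    have "golden * s + s \<ge> 0" "golden * s + s < 1" "golden * t + t < 1"
      "golden * s < golden * t + t"
      using bg(1,4,5,6,9,12) flat_golden(2)[OF st] F(1,2) fl'(3) by linarith+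
    hence "ret_coord (golden * s + s) (golden * t + t)"
      by (simp add: ret_coord_def algebra_simps golden_mult)
    thus ?thesis using shrink_inverse(1)[of s t] oblique_ret_dom by (metis image_eqI)
  qed
qed

text \<open>
  If a region \<open>X\<close> cannot be left, and neither can the condition \<open>P\<close> that selects the affine
  branch \<open>A\<close> of the return map, then the orbit is that of \<open>A\<close>.
\<close>
lemma orbit_on_one_branch:
  fixes A :: "real \<times> real \<Rightarrow> real \<times> real"
  assumes step: "\<And>s t. oblique s t \<in> X \<Longrightarrow> P (s, t) \<Longrightarrow> piso_ret (oblique s t) = case_prod oblique (A (s, t)) \<and>
        case_prod oblique (A (s, t)) \<in> X \<and> P (A (s, t))"
    and x: "oblique s t \<in> X" "P (s, t)"
  shows "(piso_ret ^^ n) (oblique s t) = case_prod oblique ((A ^^ n) (s, t))"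
proof -
  have "(piso_ret ^^ n) (oblique s t) = case_prod oblique ((A ^^ n) (s, t)) \<and>
     case_prod oblique ((A ^^ n) (s, t)) \<in> X \<and> P ((A ^^ n) (s, t))"
  proof (induction n)
    case (Suc n)
    obtain u v where "(A ^^ n) (s, t) = (u, v)" by fastforce
    thus ?case using Suc step[of u v] by simp
  qed (use x in simp)
  thus ?thesis by simp
qed

definition copies :: "complex set" where
  "copies = (\<Union>m\<in>ifs_idx. shrink m ` ret_dom)"

text \<open>
  By \<open>ret_shrink\<close> the return map permutes the copies, and it is bijective on the return
  domain; so a point outside the copies never enters them.
\<close>
lemma copies_backward:
  assumes "x \<in> ret_dom" "piso_ret x \<in> copies" shows "x \<in> copies"
proof -
  have pre: "x \<in> copies" if "m \<in> ifs_idx" "p \<in> ret_dom" "piso_ret x = piso_ret (shrink m p)" for m p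
    using inj_onD[OF ret_inj that(3) assms(1) shrink_in[OF that(2,1)]] that by (auto simp: copies_def)
  obtain m p where mp: "m \<in> ifs_idx" "p \<in> ret_dom" "piso_ret x = shrink m p"
    using assms(2) by (auto simp: copies_def)
  obtain q where q: "q \<in> ret_dom" "piso_ret q = p" using ret_surj[OF mp(2)] .
  consider "m = 0" | "m = 2" | "m = 3" | "m = 5" using mp(1) by (auto simp: ifs_idx_def)
  thus ?thesis
    using pre[of 2 p] pre[of 3 p] pre[of 5 p] pre[of 0 q] mp q ret_shrink[OF mp(2)] ret_shrink[OF q(1)]
    by cases (simp_all add: ifs_idx_def)
qed

text \<open>
  The orbit of such a point stays outside the copies, so it never changes the branch, and the
  linear part of either branch is a rotation by a nontrivial fifth root of unity.
\<close>
lemma uncovered_periodic: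
  assumes "x \<in> ret_dom" "x \<notin> copies" shows "(piso_ret ^^ 5) x = x"
proof -
  obtain s t where x: "x = oblique s t" "ret_coord s t" using assms(1) by (rule ret_domE)
  have nc: "oblique a b \<notin> shrink m ` ret_dom" if "oblique a b \<notin> copies" "m \<in> ifs_idx" for a b m
    using that by (auto simp: copies_def)
  have nx: "piso_ret y \<in> ret_dom - copies" if "y \<in> ret_dom - copies" for y
    using that copies_backward piso_ret_in by blast
  show ?thesis
  proof (rule steep_or_flat[of s t])
    assume st: "s \<le> golden * t - t"
    let ?A = "\<lambda>(s, t). (golden * t - t - s, 1 - (golden * (s + t) - (s + t)))"
    have "(piso_ret ^^ 5) (oblique s t) = case_prod oblique ((?A ^^ 5) (s, t))"
    proof (rule orbit_on_one_branch[where X = "ret_dom - copies" and P = "\<lambda>(s, t). s \<le> golden * t - t"])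
      fix a b assume ab: "oblique a b \<in> ret_dom - copies" "case (a, b) of (s, t) \<Rightarrow> s \<le> golden * t - t"
      hence b: "ret_coord a b" "a \<le> golden * b - b" by (simp_all add: oblique_ret_dom)
      have st': "golden * b - b - a \<le> golden * (1 - (golden * (a + b) - (a + b))) - (1 - (golden * (a + b) - (a + b)))"
      proof (rule ccontr)
        assume "\<not> ?thesis"
        thus False using steep_then_flat_covered[OF b] nc[of a b] ab(1) by (auto simp: ifs_idx_def not_le)
      qed
      show "piso_ret (oblique a b) = case_prod oblique (?A (a, b)) \<and> case_prod oblique (?A (a, b)) \<in> ret_dom - copies
          \<and> (case ?A (a, b) of (s, t) \<Rightarrow> s \<le> golden * t - t)"
        using st' nx[OF ab(1)] ret_steep[OF b] by simp
    qed (use x assms st in auto)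
    also have "(?A ^^ 5) (s, t) = (s, t)"
      by (simp add: eval_nat_numeral algebra_simps golden_mult)
    finally show ?thesis using x by simp
  next
    assume st: "golden * t - t < s"
    let ?A = "\<lambda>(s, t). (t, golden * t - t - s + 1)"
    have "(piso_ret ^^ 5) (oblique s t) = case_prod oblique ((?A ^^ 5) (s, t))"
    proof (rule orbit_on_one_branch[where X = "ret_dom - copies" and P = "\<lambda>(s, t). golden * t - t < s"])
      fix a b assume ab: "oblique a b \<in> ret_dom - copies" "case (a, b) of (s, t) \<Rightarrow> golden * t - t < s"
      hence b: "ret_coord a b" "golden * b - b < a" by (simp_all add: oblique_ret_dom)
      have fl': "golden * (golden * b - b - a + 1) - (golden * b - b - a + 1) < b"
      proof (rule ccontr)
        assume "\<not> ?thesis"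
        thus False using flat_then_steep_covered[OF b] nc[of a b] ab(1) by (auto simp: ifs_idx_def not_less)
      qed
      show "piso_ret (oblique a b) = case_prod oblique (?A (a, b)) \<and> case_prod oblique (?A (a, b)) \<in> ret_dom - copies
          \<and> (case ?A (a, b) of (s, t) \<Rightarrow> golden * t - t < s)"
        using fl' nx[OF ab(1)] ret_flat[OF b] by simp
    qed (use x assms st in auto)
    also have "(?A ^^ 5) (s, t) = (s, t)"
      by (simp add: eval_nat_numeral algebra_simps golden_mult)
    finally show ?thesis using x by simp
  qed
qed

section \<open>Renormalisation of aperiodic points\<close>

definition ret_aperiodic :: "complex set" where
  "ret_aperiodic = {x \<in> ret_dom. \<forall>n>0. (piso_ret ^^ n) x \<noteq> x}"

lemma orbit_ret_dom: "x \<in> ret_dom \<Longrightarrow> (piso_ret ^^ n) x \<in> ret_dom"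
  by (induction n) (auto intro: piso_ret_in)

lemma piso_ret_orbit:
  assumes "x \<in> ret_dom" shows "\<exists>k\<ge>n. (piso_ret ^^ n) x = (piso ^^ k) x"
proof (induction n)
  case (Suc n)
  then obtain k where k: "k \<ge> n" "(piso_ret ^^ n) x = (piso ^^ k) x" by blast
  have "(piso_ret ^^ n) x \<in> ret_dom" by (rule orbit_ret_dom[OF assms])
  hence "piso_ret ((piso_ret ^^ n) x) = (piso ^^ Suc k) x \<or> piso_ret ((piso_ret ^^ n) x) = (piso ^^ Suc (Suc k)) x"
    unfolding ret_dom_def k(2) by (simp add: piso_ret_explicit)
  thus ?case using k(1) by (metis Suc_le_mono funpow.simps(2) comp_apply le_SucI)
qed (auto intro: exI[of _ 0])

text \<open>
  A return to the starting point under the first return map is a return under \<open>piso\<close>.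
\<close>
lemma aperiodic_pts_ret_aperiodic: "x \<in> aperiodic_pts \<inter> piso ` dom_Z \<Longrightarrow> x \<in> ret_aperiodic"
proof -
  assume x: "x \<in> aperiodic_pts \<inter> piso ` dom_Z"
  have "(piso_ret ^^ n) x \<noteq> x" if "n > 0" for n
  proof -
    obtain k where k: "k \<ge> n" "(piso_ret ^^ n) x = (piso ^^ k) x"
      using piso_ret_orbit[of x n] x by (auto simp: ret_dom_def)
    hence "k > 0" using that by simp
    moreover have "\<forall>j>0. (piso ^^ j) x \<noteq> x" using x unfolding aperiodic_pts_def by blast
    ultimately show ?thesis using k(2) by simp
  qed
  thus "x \<in> ret_aperiodic" using x by (simp add: ret_aperiodic_def ret_dom_def)
qed

lemma ret_aperiodic_step:
  assumes "x \<in> ret_aperiodic" shows "piso_ret x \<in> ret_aperiodic"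
proof -
  have x: "x \<in> ret_dom" using assms by (simp add: ret_aperiodic_def)
  have "(piso_ret ^^ n) (piso_ret x) \<noteq> piso_ret x" if "n > 0" for n
  proof
    assume "(piso_ret ^^ n) (piso_ret x) = piso_ret x"
    hence "piso_ret ((piso_ret ^^ n) x) = piso_ret x" by (simp add: funpow_swap1)
    hence "(piso_ret ^^ n) x = x" using ret_inj orbit_ret_dom[OF x] x by (auto dest: inj_onD)
    thus False using assms that by (simp add: ret_aperiodic_def)
  qed
  thus ?thesis using x piso_ret_in by (simp add: ret_aperiodic_def)
qed

lemma orbit_ret_aperiodic: "x \<in> ret_aperiodic \<Longrightarrow> (piso_ret ^^ n) x \<in> ret_aperiodic"
  by (induction n) (auto intro: ret_aperiodic_step)

lemma ret_power4_shrink: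
  assumes "p \<in> ret_dom" "m \<in> ifs_idx"
  shows "(piso_ret ^^ 4) (shrink m p) = shrink m (piso_ret p)"
  using assms(2) ret_shrink[OF assms(1)] ret_shrink[OF piso_ret_in[OF assms(1)]]
  by (auto simp: ifs_idx_def eval_nat_numeral)

lemma ret_power_shrink:
  assumes "p \<in> ret_dom" "m \<in> ifs_idx"
  shows "(piso_ret ^^ (4 * n)) (shrink m p) = shrink m ((piso_ret ^^ n) p)"
proof (induction n)
  case (Suc n)
  have "(piso_ret ^^ (4 * Suc n)) (shrink m p) = (piso_ret ^^ 4) ((piso_ret ^^ (4 * n)) (shrink m p))"
    by (simp flip: funpow_add comp_apply[of "piso_ret ^^ 4"])
  also have "\<dots> = shrink m (piso_ret ((piso_ret ^^ n) p))"
    unfolding Suc by (rule ret_power4_shrink[OF orbit_ret_dom[OF assms(1)] assms(2)])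
  finally show ?case by simp
qed simp

text \<open>
  If \<open>p\<close> were periodic with period \<open>n\<close>, then \<open>shrink m p\<close> would be periodic with period \<open>4 * n\<close>.
\<close>
lemma ret_aperiodic_shrink:
  assumes "x \<in> ret_aperiodic" shows "\<exists>m\<in>ifs_idx. \<exists>p\<in>ret_aperiodic. x = shrink m p"
proof -
  have x: "x \<in> ret_dom" "\<And>n. n > 0 \<Longrightarrow> (piso_ret ^^ n) x \<noteq> x" using assms by (auto simp: ret_aperiodic_def)
  hence "x \<in> copies" using uncovered_periodic[of x] by fastforce
  then obtain m p where mp: "m \<in> ifs_idx" "p \<in> ret_dom" "x = shrink m p" by (auto simp: copies_def)
  have "(piso_ret ^^ n) p \<noteq> p" if "n > 0" for n
    using x(2)[of "4 * n"] that ret_power_shrink[OF mp(2,1), of n] mp(3) by auto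
  thus ?thesis using mp by (auto simp: ret_aperiodic_def)
qed

section \<open>The attractor and the self-similar measure\<close>

interpretation pentagon: iterated_function_system ifs_idx shrink "1 / golden\<^sup>2"
proof
  show "1 / golden\<^sup>2 < 1" using golden_pos by (simp add: power_less_one_iff)
  have "norm zeta5 = 1" by (simp add: zeta5_cis)
  hence z: "norm (zeta5 ^ m / of_real (golden\<^sup>2)) = 1 / golden\<^sup>2" for m
    by (simp add: norm_divide norm_power)
  fix m :: nat and x y
  have "shrink m x - shrink m y = zeta5 ^ m / of_real (golden\<^sup>2) * (x - y)"
    by (simp add: shrink_def right_diff_distrib)
  thus "dist (shrink m x) (shrink m y) \<le> 1 / golden\<^sup>2 * dist x y"
    unfolding dist_norm by (simp only: norm_mult z)
qed (auto simp: ifs_idx_def)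

lemma attractor_is_attractor: "pentagon.is_attractor attractor"
proof -
  have char: "pentagon.is_attractor Y \<longleftrightarrow> Y \<noteq> {} \<and> compact Y \<and>
     Y = (\<Union>m\<in>ifs_idx. (\<lambda>y. zeta5 ^ m / of_real (golden\<^sup>2) * y + ifs_d m) ` Y)" for Y
  proof -
    have "(\<lambda>y. zeta5 ^ m / of_real (golden\<^sup>2) * y + ifs_d m) = shrink m" for m
      by (simp add: shrink_def fun_eq_iff)
    thus ?thesis by (simp only: pentagon.is_attractor_def pentagon.hutchinson_def)
  qed
  have "\<exists>!Y. pentagon.is_attractor Y"
    using pentagon.attractor_exists pentagon.attractor_unique by blast
  moreover have "attractor = (THE Y. pentagon.is_attractor Y)" by (simp only: attractor_def char)
  ultimately show ?thesis using theI' by metis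
qed

text \<open>
  The images under the inverse similarities in the definition of the measure are the preimages
  under the similarities.
\<close>
lemma self_sim_measure_invariant: "pentagon.invariant_prob attractor self_sim_measure"
proof -
  have nz: "zeta5 \<noteq> 0" "golden \<noteq> 0"
    using golden_pos by (simp_all add: zeta5_def)
  have inv1: "of_real (golden\<^sup>2) / zeta5 ^ m * (shrink m x - ifs_d m) = x" for m x
    using nz by (simp add: shrink_def)
  have inv2: "shrink m (of_real (golden\<^sup>2) / zeta5 ^ m * (x - ifs_d m)) = x" for m x
    using nz by (simp add: shrink_def)
  have image: "(\<lambda>x. of_real (golden\<^sup>2) / zeta5 ^ m * (x - ifs_d m)) ` X = shrink m -` X" for m X
  proof (intro equalityI subsetI)
    fix y assume "y \<in> shrink m -` X"
    thus "y \<in> (\<lambda>x. of_real (golden\<^sup>2) / zeta5 ^ m * (x - ifs_d m)) ` X"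
      by (intro image_eqI[where x = "shrink m y"]) (simp_all only: inv1 vimage_eq)
  next
    fix y assume "y \<in> (\<lambda>x. of_real (golden\<^sup>2) / zeta5 ^ m * (x - ifs_d m)) ` X"
    then obtain x where "x \<in> X" "y = of_real (golden\<^sup>2) / zeta5 ^ m * (x - ifs_d m)" by blast
    thus "y \<in> shrink m -` X" by (simp only: inv2 vimage_eq)
  qed
  have card: "card ifs_idx = 4" by (simp add: ifs_idx_def)
  have char: "pentagon.invariant_prob attractor M \<longleftrightarrow> prob_space M \<and> sets M = sets borel \<and> measure M attractor = 1 \<and>
     (\<forall>X\<in>sets borel. measure M X =
        1 / 4 * (\<Sum>m\<in>ifs_idx.
          measure M ((\<lambda>x. of_real (golden\<^sup>2) / zeta5 ^ m * (x - ifs_d m)) ` X)))" for M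
    unfolding pentagon.invariant_prob_def image card by simp
  have "\<exists>!M. pentagon.invariant_prob attractor M"
    using pentagon.invariant_prob_exists[OF attractor_is_attractor]
      pentagon.invariant_prob_unique[OF attractor_is_attractor] by blast
  moreover have "self_sim_measure = (THE M. pentagon.invariant_prob attractor M)"
    by (simp only: self_sim_measure_def char)
  ultimately show ?thesis using theI' by metis
qed

text \<open>
  The aperiodic points form a bounded set that is covered by its own images.
\<close>
lemma ret_aperiodic_subset_attractor: "ret_aperiodic \<subseteq> attractor"
proof (rule pentagon.bounded_subset_attractor[OF attractor_is_attractor])
  have "norm (oblique s t) \<le> 1 + 1" if "ret_coord s t" for s t
  proof -
    have i: "norm (inverse zeta5) = 1" by (simp add: zeta5_cis norm_inverse)
    have "norm (oblique s t) \<le> \<bar>s\<bar> + \<bar>t\<bar>"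
      unfolding oblique_def by (rule order_trans[OF norm_triangle_ineq4]) (simp add: norm_mult i del: norm_inverse)
    thus ?thesis using that ret_coord_pos[OF that] by (simp add: ret_coord_def)
  qed
  hence "\<forall>x\<in>ret_dom. norm x \<le> 2" by (auto elim: ret_domE)
  thus "bounded ret_aperiodic" by (intro boundedI[of _ 2]) (auto simp: ret_aperiodic_def)
  show "ret_aperiodic \<subseteq> pentagon.hutchinson ret_aperiodic"
    using ret_aperiodic_shrink by (fastforce simp: pentagon.hutchinson_def)
qed

section \<open>Orbit averages\<close>

definition orbit_avg :: "(complex \<Rightarrow> real) \<Rightarrow> nat \<Rightarrow> complex \<Rightarrow> real" where
  "orbit_avg F N x = (\<Sum>n<N. F ((piso_ret ^^ n) x)) / real N"

text \<open>
  The orbit of \<open>shrink 5 p\<close> falls into blocks of four, each consisting of the images of one point of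
  the orbit of \<open>p\<close> under the four similarities; the sum over a block is four times a value of the transfer.
\<close>
lemma sum_four_returns:
  assumes p: "p \<in> ret_dom"
  shows "(\<Sum>n<4 * q. F ((piso_ret ^^ n) (shrink 5 p))) = 4 * (\<Sum>i<q. pentagon.transfer F ((piso_ret ^^ i) p))"
proof (induction q)
  case (Suc q)
  let ?x = "shrink 5 p" and ?p = "(piso_ret ^^ q) p"
  have e: "(piso_ret ^^ (4 * q)) ?x = shrink 5 ?p" by (rule ret_power_shrink[OF p]) (simp add: ifs_idx_def)
  have "4 * Suc q = Suc (Suc (Suc (Suc (4 * q))))" by simp
  hence "(\<Sum>n<4 * Suc q. F ((piso_ret ^^ n) ?x)) = (\<Sum>n<4 * q. F ((piso_ret ^^ n) ?x)) +
     (F (shrink 5 ?p) + F (shrink 3 ?p) + F (shrink 2 ?p) + F (shrink 0 ?p))"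
    by (simp only: sum.lessThan_Suc funpow.simps comp_apply e ret_shrink[OF orbit_ret_dom[OF p, of q]] add.assoc)
  also have "F (shrink 5 ?p) + F (shrink 3 ?p) + F (shrink 2 ?p) + F (shrink 0 ?p) = 4 * pentagon.transfer F ?p"
    unfolding pentagon.transfer_def by (simp add: ifs_idx_def)
  finally show ?case using Suc by simp
qed simp

lemma shrink_on_orbit:
  assumes "p \<in> ret_dom" "m \<in> ifs_idx"
  shows "\<exists>r<4. shrink m p = (piso_ret ^^ r) (shrink 5 p)"
proof -
  have "shrink 5 p = (piso_ret ^^ 0) (shrink 5 p)" "shrink 3 p = (piso_ret ^^ 1) (shrink 5 p)"
    "shrink 2 p = (piso_ret ^^ 2) (shrink 5 p)" "shrink 0 p = (piso_ret ^^ 3) (shrink 5 p)"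
    using ret_shrink[OF assms(1)] by (simp_all add: eval_nat_numeral)
  thus ?thesis using assms(2) by (auto simp: ifs_idx_def intro: exI[of _ "0::nat"] exI[of _ "1::nat"] exI[of _ "2::nat"] exI[of _ "3::nat"])
qed

text \<open>
  The orbit of \<open>shrink m p\<close> is that of \<open>shrink 5 p\<close> with at most three terms removed at the start,
  so its sums differ from sums over full blocks by a bounded number of terms.
\<close>
lemma orbit_avg_shrink:
  assumes p: "p \<in> ret_dom" and m: "m \<in> ifs_idx" and C: "\<And>x. \<bar>F x\<bar> \<le> C"
  shows "(\<lambda>N. orbit_avg F N (shrink m p) - orbit_avg (pentagon.transfer F) (N div 4) p) \<longlonglongrightarrow> 0"
proof -
  let ?a = "\<lambda>n. F ((piso_ret ^^ n) (shrink 5 p))" and ?b = "\<lambda>i. pentagon.transfer F ((piso_ret ^^ i) p)"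
  obtain r where r: "r < 4" "shrink m p = (piso_ret ^^ r) (shrink 5 p)" using shrink_on_orbit[OF p m] by blast
  have C0: "C \<ge> 0" using C[of 0] by simp
  have bnd: "\<bar>sum ?a S\<bar> \<le> real (card S) * C" for S
    by (rule order_trans[OF sum_abs]) (rule order_trans[OF sum_bounded_above[where K = C]], use C in auto)
  have bndT: "\<bar>\<Sum>i<q. ?b i\<bar> \<le> real q * C" for q
    by (rule order_trans[OF sum_abs]) (rule order_trans[OF sum_bounded_above[where K = C]], use pentagon.transfer_bound[OF C] in auto)
  have est: "norm (orbit_avg F N (shrink m p) - orbit_avg (pentagon.transfer F) (N div 4) p) \<le> 12 * C / real N"
    if N: "N \<ge> 4" for N
  proof -
    define q where "q = N div 4"
    have q: "q > 0" "4 * q \<le> N" "N < 4 * q + 4" using N by (auto simp: q_def)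
    define E where "E = (\<Sum>i<q. ?b i)"
    have "(\<Sum>n<N. F ((piso_ret ^^ n) (shrink m p))) = (\<Sum>n<N. ?a (n + r))"
      by (simp add: r(2) funpow_add)
    also have "\<dots> = (\<Sum>n\<in>{r..<N + r}. ?a n)"
      by (rule sum.reindex_bij_witness[of _ "\<lambda>n. n - r" "\<lambda>n. n + r"]) auto
    also have "\<dots> = sum ?a {..<4 * q} - sum ?a {..<r} + sum ?a {4 * q..<N + r}"
    proof -
      have "{..<N + r} = {..<r} \<union> {r..<N + r}" "{..<N + r} = {..<4 * q} \<union> {4 * q..<N + r}" using q by auto
      hence "sum ?a {..<N + r} = sum ?a {..<r} + sum ?a {r..<N + r}"
        "sum ?a {..<N + r} = sum ?a {..<4 * q} + sum ?a {4 * q..<N + r}"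
        by (metis sum.union_disjoint finite_lessThan finite_atLeastLessThan ivl_disj_int_one(2))+
      thus ?thesis by simp
    qed
    finally have S: "(\<Sum>n<N. F ((piso_ret ^^ n) (shrink m p))) = 4 * E - sum ?a {..<r} + sum ?a {4 * q..<N + r}"
      by (simp add: sum_four_returns[OF p] E_def)
    \<comment> \<open>Three errors: the shift of the start, the incomplete last block, and the normalisation by \<open>N\<close> instead of \<open>4 * q\<close>.\<close>
    have b1: "\<bar>sum ?a {..<r}\<bar> \<le> 3 * C"
      using bnd[of "{..<r}"] r(1) C0 mult_right_mono[of "real r" 3 C] by simp
    have b2: "\<bar>sum ?a {4 * q..<N + r}\<bar> \<le> 6 * C"
      using bnd[of "{4 * q..<N + r}"] r(1) q C0 mult_right_mono[of "real (N + r - 4 * q)" 6 C] by simp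
    have b3: "\<bar>4 * E - real N * (E / real q)\<bar> \<le> 3 * C"
    proof -
      have "4 * E - real N * (E / real q) = (4 * real q - real N) * (E / real q)" using q by (simp add: field_simps)
      also have "\<bar>\<dots>\<bar> \<le> 3 * C"
        unfolding abs_mult using bndT[of q] q by (intro mult_mono) (auto simp: E_def field_simps)
      finally show ?thesis .
    qed
    have "orbit_avg F N (shrink m p) - orbit_avg (pentagon.transfer F) q p
        = ((4 * E - real N * (E / real q)) - sum ?a {..<r} + sum ?a {4 * q..<N + r}) / real N"
      unfolding orbit_avg_def S E_def[symmetric] using N by (simp add: field_simps)
    also have "\<bar>\<dots>\<bar> \<le> 12 * C / real N"
      unfolding abs_divide using b1 b2 b3 by (intro divide_mono) (use N in auto)
    finally show ?thesis by (simp add: q_def)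
  qed
  have "(\<lambda>N. 12 * C / real N) \<longlonglongrightarrow> 0" by (rule lim_const_over_n)
  moreover have "\<forall>\<^sub>F N in sequentially. norm (orbit_avg F N (shrink m p)
      - orbit_avg (pentagon.transfer F) (N div 4) p) \<le> 12 * C / real N"
    using eventually_ge_at_top[of 4] by (rule eventually_mono) (rule est)
  ultimately show ?thesis by (rule Lim_null_comparison[rotated])
qed

lemma orbit_avg_renormalised:
  assumes F: "\<And>x. \<bar>F x\<bar> \<le> C" and x: "x \<in> ret_aperiodic"
  shows "\<exists>p\<in>ret_aperiodic. (\<lambda>N. orbit_avg F N x - orbit_avg ((pentagon.transfer ^^ k) F) (N div 4 ^ k) p) \<longlonglongrightarrow> 0"
proof (induction k)
  case (Suc k)
  let ?G = "(pentagon.transfer ^^ k) F"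
  from Suc obtain p where p: "p \<in> ret_aperiodic" "(\<lambda>N. orbit_avg F N x - orbit_avg ?G (N div 4 ^ k) p) \<longlonglongrightarrow> 0" by blast
  obtain m q where q: "m \<in> ifs_idx" "q \<in> ret_aperiodic" "p = shrink m q" using ret_aperiodic_shrink[OF p(1)] by blast
  have G: "\<bar>?G y\<bar> \<le> C" for y by (induction k arbitrary: y) (use F pentagon.transfer_bound in auto)
  have "(\<lambda>N. orbit_avg ?G N p - orbit_avg (pentagon.transfer ?G) (N div 4) q) \<longlonglongrightarrow> 0"
    unfolding q(3) using q(2) by (intro orbit_avg_shrink[OF _ q(1) G]) (simp add: ret_aperiodic_def)
  moreover have "filterlim (\<lambda>N. N div 4 ^ k) sequentially sequentially"
    unfolding filterlim_at_top
    by (auto simp: eventually_sequentially less_eq_div_iff_mult_less_eq intro!: exI[of _ "_ * 4 ^ k"])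
  ultimately have "(\<lambda>N. orbit_avg ?G (N div 4 ^ k) p - orbit_avg (pentagon.transfer ?G) (N div 4 ^ k div 4) q) \<longlonglongrightarrow> 0"
    by (rule filterlim_compose)
  hence "(\<lambda>N. orbit_avg ?G (N div 4 ^ k) p - orbit_avg (pentagon.transfer ?G) (N div 4 ^ Suc k) q) \<longlonglongrightarrow> 0"
    by (simp add: div_mult2_eq[symmetric] mult.commute)
  from tendsto_add[OF p(2) this] q(2) show ?case
    by (intro bexI[of _ q]) simp_all
qed (use x in \<open>auto intro: bexI[of _ x]\<close>)

text \<open>
  Renormalise until the transferred function is within \<open>e / 2\<close> of the integral on the whole attractor,
  which contains the renormalised orbit; then its averages are as close, whatever their length.
\<close>
lemma orbit_avg_converges:
  assumes F: "continuous_on UNIV F" "\<And>x. \<bar>F x\<bar> \<le> C" and x: "x \<in> ret_aperiodic"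
  shows "(\<lambda>N. orbit_avg F N x) \<longlonglongrightarrow> (\<integral>y. F y \<partial>self_sim_measure)"
proof (rule LIMSEQ_I)
  fix e :: real assume e: "e > 0"
  let ?I = "\<integral>y. F y \<partial>self_sim_measure"
  obtain k where k: "\<And>p y. p \<in> attractor \<Longrightarrow> y \<in> attractor \<Longrightarrow>
      \<bar>(pentagon.transfer ^^ k) F p - (pentagon.transfer ^^ k) F y\<bar> \<le> e / 2"
    using pentagon.transfer_oscillation[OF attractor_is_attractor F(1), of "e / 2"] e by auto
  let ?G = "(pentagon.transfer ^^ k) F"
  have near: "\<bar>?G p - ?I\<bar> \<le> e / 2" if "p \<in> ret_aperiodic" for p
    using that ret_aperiodic_subset_attractor
    by (intro pentagon.transfer_near_integral[OF attractor_is_attractor self_sim_measure_invariant F k]) auto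
  obtain p where p: "p \<in> ret_aperiodic" "(\<lambda>N. orbit_avg F N x - orbit_avg ?G (N div 4 ^ k) p) \<longlonglongrightarrow> 0"
    using orbit_avg_renormalised[of F C x k] F(2) x by blast
  have avg: "\<bar>orbit_avg ?G N p - ?I\<bar> \<le> e / 2" if N: "N > 0" for N
  proof -
    have "orbit_avg ?G N p - ?I = (\<Sum>n<N. ?G ((piso_ret ^^ n) p) - ?I) / real N"
      using N by (simp add: orbit_avg_def sum_subtractf field_simps)
    also have "\<bar>\<dots>\<bar> \<le> (\<Sum>n<N. e / 2) / real N"
      unfolding abs_divide using near[OF orbit_ret_aperiodic[OF p(1)]] N
      by (intro divide_mono order_trans[OF sum_abs] sum_mono) auto
    finally show ?thesis using N by simp
  qed
  obtain N0 where N0: "\<And>N. N \<ge> N0 \<Longrightarrow> \<bar>orbit_avg F N x - orbit_avg ?G (N div 4 ^ k) p\<bar> < e / 2"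
    using LIMSEQ_D[OF p(2), of "e / 2"] e by auto
  show "\<exists>n0. \<forall>n\<ge>n0. norm (orbit_avg F n x - ?I) < e"
  proof (intro exI allI impI)
    fix n assume n: "n \<ge> max N0 (4 ^ k)"
    hence "n div 4 ^ k > 0" by (simp add: div_greater_zero_iff)
    from avg[OF this] N0[of n] n have "\<bar>orbit_avg F n x - ?I\<bar> < e" by linarith
    thus "norm (orbit_avg F n x - ?I) < e" by simp
  qed
qed

text \<open>
  Since the orbit and the mass of the measure are both in the attractor, \<open>f\<close> may be replaced by a bounded
  continuous extension to the plane.
\<close>
theorem corollary4:
  fixes x :: complex and f :: "complex \<Rightarrow> real"
  assumes "x \<in> aperiodic_pts \<inter> piso ` dom_Z"
    and "continuous_on attractor f"
  shows "(\<lambda>N. (1 / real N) * (\<Sum>n<N. f ((piso_ret ^^ n) x)))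
           \<longlonglongrightarrow> (LINT y:attractor|self_sim_measure. f y)"
proof -
  have x: "x \<in> ret_aperiodic" using assms(1) by (rule aperiodic_pts_ret_aperiodic)
  have cpt: "compact attractor" using attractor_is_attractor by (simp add: pentagon.is_attractor_def)
  obtain C where "C > 0" "\<forall>z\<in>f ` attractor. norm z \<le> C"
    using compact_imp_bounded[OF compact_continuous_image[OF assms(2) cpt]]
    unfolding bounded_pos by blast
  hence C: "C \<ge> 0" "\<And>y. y \<in> attractor \<Longrightarrow> norm (f y) \<le> C" by simp_all
  have cl: "closedin (top_of_set UNIV) attractor"
    using compact_imp_closed[OF cpt] by simp
  obtain F where F: "continuous_on UNIV F" "\<And>y. y \<in> attractor \<Longrightarrow> F y = f y" "\<And>y. norm (F y) \<le> C"
  proof -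
    have "\<exists>F. continuous_on UNIV F \<and> (\<forall>y\<in>attractor. F y = f y) \<and> (\<forall>y. norm (F y) \<le> C)"
    proof (rule Tietze[OF assms(2) cl C(1)])
      fix F assume "continuous_on UNIV F" "\<And>y. y \<in> attractor \<Longrightarrow> F y = f y" "\<And>y. y \<in> UNIV \<Longrightarrow> norm (F y) \<le> C"
      thus ?thesis by (intro exI[of _ F]) simp
    qed (rule C(2))
    thus ?thesis using that by blast
  qed
  interpret prob_space self_sim_measure
    using self_sim_measure_invariant by (simp add: pentagon.invariant_prob_def)
  have ss: "sets self_sim_measure = sets borel" "prob attractor = 1"
    using self_sim_measure_invariant by (simp_all add: pentagon.invariant_prob_def)
  have AEY: "AE y in self_sim_measure. y \<in> attractor"
    using prob_eq_1[of attractor] ss cpt by (simp add: compact_imp_closed)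
  have "(LINT y:attractor|self_sim_measure. f y) = (LINT y:attractor|self_sim_measure. F y)"
    unfolding set_lebesgue_integral_def
    by (intro Bochner_Integration.integral_cong) (auto simp: F(2) indicator_def)
  also have "\<dots> = (\<integral>y. F y \<partial>self_sim_measure)"
    unfolding set_lebesgue_integral_def
  proof (rule integral_cong_AE)
    note [measurable_cong] = ss(1)
    have [measurable]: "F \<in> borel_measurable borel" by (rule borel_measurable_continuous_onI[OF F(1)])
    have [measurable]: "attractor \<in> sets borel" using cpt by (simp add: compact_imp_closed)
    show "(\<lambda>y. indicat_real attractor y *\<^sub>R F y) \<in> borel_measurable self_sim_measure" by measurable
    show "F \<in> borel_measurable self_sim_measure" by measurable
  qed (use AEY in auto)
  finally have int: "(LINT y:attractor|self_sim_measure. f y) = (\<integral>y. F y \<partial>self_sim_measure)" .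
  have "(1 / real N) * (\<Sum>n<N. f ((piso_ret ^^ n) x)) = orbit_avg F N x" for N
    using orbit_ret_aperiodic[OF x] ret_aperiodic_subset_attractor F(2) by (simp add: orbit_avg_def subset_iff)
  thus ?thesis using orbit_avg_converges[OF F(1) _ x, of C] F(3) unfolding int by simp
qed

end
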